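(* A permutation $\pi$ satisfies $S^3(\pi)=\mathrm{id}$ (i.e. $\pi$ is West-$3$-stack-sortable) if and only if $\pi$ avoids all of the following ten patterns (each written as: underlying classical pattern; set of shaded boxes; decorated region, if any): 1. $23451$; no shaded boxes. 2. $24351$; shaded $\{(2,4),(2,5)\}$. 3. $32451$; shaded $\{(1,3),(1,4),(1,5)\}$. 4. $42351$; shaded $\{(1,4),(1,5),(2,4),(2,5)\}$. 5. $43251$; shaded $\{(1,4),(1,5),(2,3),(2,4),(2,5)\}$. 6. $34251$; shaded $\{(1,3),(1,4),(1,5),(2,4),(2,5)\}$. 7. $362451$; shaded $\{(0,4),(0,5),(1,3),(1,4),(1,5),(1,6),(2,4),(2,6)\}$; decorated region $\{(2,5)\}$. 8. $364251$; shaded $\{(0,4),(0,5),(1,3),(1,4),(1,5),(1,6),(2,4),(2,6),(3,4),(3,5),(3,6)\}$; decorated region $\{(2,5)\}$. 9. $7362451$; shaded $\{(1,4),(1,5),(1,6),(1,7),(2,3),(2,4),(2,5),(2,6),(2,7),(3,4),(3,6),(3,7)\}$; decorated region $\{(3,5)\}$. 10. $7364251$; shaded $\{(1,4),(1,5),(1,6),(1,7),(2,3),(2,4),(2,5),(2,6),(2,7),(3,4),(3,6),(3,7),(4,4),(4,5),(4,6),(4,7)\}$; decorated region $\{(3,5)\}$.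
   Context: Permutations are in one-line notation; $\mathrm{id}$ is the identity permutation. For a sequence $w$ of distinct integers, the stack-sort $S(w)$ is defined by $S(\varepsilon)=\varepsilon$ and $S(\alpha m\beta)=S(\alpha)S(\beta)m$ where $m$ is the largest entry of $w$ (equivalently: read $w$ left to right; before pushing an entry onto a stack, pop to the output all stack entries smaller than it; at the end pop the remaining stack). $S^3=S\circ S\circ S$. A permutation $\pi$ of length $n$ contains the classical pattern $p$ of length $k$ if there are positions $i_1<\dots<i_k$ with $\pi(i_1)\cdots\pi(i_k)$ order-isomorphic to $p$; these entries form an occurrence. For an occurrence with positions $i_1<\dots<i_k$ and values $v_1<\dots<v_k$, set $i_0=v_0=0$, $i_{k+1}=v_{k+1}=n+1$; for $0\le a,b\le k$ the box $(a,b)$ is the set of entries $\pi(x)$ with $i_a<x<i_{a+1}$ and $v_b<\pi(x)<v_{b+1}$. A pattern with shaded boxes $R$ and decorated region $D$ (sets of boxes) occurs in $\pi$ if there is an occurrence of the underlying classical pattern such that every box in $R$ contains no entry of $\pi$, and the entries of $\pi$ lying in the union of the boxes of $D$, read left to right, form a decreasing sequence (i.e. avoid the pattern $12$). $\pi$ avoids a pattern if it has no occurrence of it. *)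

theory Defs
  imports Main
begin

definition is_perm :: "nat list \<Rightarrow> bool" where
  "is_perm w \<longleftrightarrow> distinct w \<and> set w = {1..length w}"

lemma takeWhile_len_less: "m \<in> set w \<Longrightarrow> length (takeWhile (\<lambda>y. y \<noteq> m) w) < length w"
  by (induction w) auto

function stack_sort :: "nat list \<Rightarrow> nat list" where
  "stack_sort [] = []"
| "stack_sort (x # xs) =
     (let w = x # xs; m = Max (set w)
      in stack_sort (takeWhile (\<lambda>y. y \<noteq> m) w)
         @ stack_sort (tl (dropWhile (\<lambda>y. y \<noteq> m) w)) @ [m])"
  by pat_completeness auto
lemma dropWhile_len_le: "w \<noteq> [] \<Longrightarrow> length (tl (dropWhile P w)) < length w"
  using length_dropWhile_le[of P w] by (cases w) auto

termination
proof (relation "measure length", goal_cases)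
  case 1 show ?case by simp
next
  case (2 x xs w m)
  have "m \<in> set w" using 2 Max_in[of "set w"] by simp
  then have "length (takeWhile (\<lambda>y. y \<noteq> m) w) < length w" by (rule takeWhile_len_less)
  then show ?case using 2 by (simp only: in_measure)
next
  case (3 x xs w m)
  then show ?case using dropWhile_len_le[of w "\<lambda>y. y \<noteq> m"] by auto
qed

text \<open>A pattern with shaded boxes and a decorated region: (classical pattern, shaded boxes, decorated boxes).
  Pattern lists use values 1..k; boxes are pairs (a,b) with 0 \<le> a,b \<le> k.\<close>
type_synonym dpattern = "nat list \<times> (nat \<times> nat) set \<times> (nat \<times> nat) set"

text \<open>Occurrence given by 1-based positions ps = [i_1,...,i_k] in w (length n).
  Extended positions i_0 = 0, i_(k+1) = n+1; extended values v_0 = 0, v_(k+1) = n+1.\<close>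
definition occ_pos :: "nat list \<Rightarrow> nat list \<Rightarrow> nat \<Rightarrow> nat" where
  "occ_pos w ps a = (if a = 0 then 0 else if a \<le> length ps then ps ! (a - 1) else length w + 1)"

definition occ_val :: "nat list \<Rightarrow> nat list \<Rightarrow> nat \<Rightarrow> nat" where
  "occ_val w ps b = (if b = 0 then 0 else if b \<le> length ps
      then sort (map (\<lambda>i. w ! (i - 1)) ps) ! (b - 1) else length w + 1)"

definition in_box :: "nat list \<Rightarrow> nat list \<Rightarrow> nat \<times> nat \<Rightarrow> nat \<Rightarrow> bool" where
  "in_box w ps ab x \<longleftrightarrow> 1 \<le> x \<and> x \<le> length w \<and>
     occ_pos w ps (fst ab) < x \<and> x < occ_pos w ps (fst ab + 1) \<and>
     occ_val w ps (snd ab) < w ! (x - 1) \<and> w ! (x - 1) < occ_val w ps (snd ab + 1)"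

definition is_occurrence :: "dpattern \<Rightarrow> nat list \<Rightarrow> nat list \<Rightarrow> bool" where
  "is_occurrence P w ps \<longleftrightarrow>
     (let p = fst P; R = fst (snd P); D = snd (snd P) in
      length ps = length p \<and> sorted_wrt (<) ps \<and> set ps \<subseteq> {1..length w} \<and>
      (\<forall>a < length p. \<forall>b < length p. (w ! (ps ! a - 1) < w ! (ps ! b - 1) \<longleftrightarrow> p ! a < p ! b)) \<and>
      (\<forall>ab \<in> R. \<forall>x. \<not> in_box w ps ab x) \<and>
      (\<forall>x y. x < y \<and> (\<exists>ab \<in> D. in_box w ps ab x) \<and> (\<exists>ab \<in> D. in_box w ps ab y)
             \<longrightarrow> w ! (x - 1) > w ! (y - 1)))"

definition contains_pat :: "nat list \<Rightarrow> dpattern \<Rightarrow> bool" where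
  "contains_pat w P \<longleftrightarrow> (\<exists>ps. is_occurrence P w ps)"

definition avoids_pat :: "nat list \<Rightarrow> dpattern \<Rightarrow> bool" where
  "avoids_pat w P \<longleftrightarrow> \<not> contains_pat w P"

definition west3_patterns :: "dpattern list" where
  "west3_patterns = [
    ([2,3,4,5,1], {}, {}),
    ([2,4,3,5,1], {(2,4),(2,5)}, {}),
    ([3,2,4,5,1], {(1,3),(1,4),(1,5)}, {}),
    ([4,2,3,5,1], {(1,4),(1,5),(2,4),(2,5)}, {}),
    ([4,3,2,5,1], {(1,4),(1,5),(2,3),(2,4),(2,5)}, {}),
    ([3,4,2,5,1], {(1,3),(1,4),(1,5),(2,4),(2,5)}, {}),
    ([3,6,2,4,5,1], {(0,4),(0,5),(1,3),(1,4),(1,5),(1,6),(2,4),(2,6)}, {(2,5)}),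
    ([3,6,4,2,5,1], {(0,4),(0,5),(1,3),(1,4),(1,5),(1,6),(2,4),(2,6),(3,4),(3,5),(3,6)}, {(2,5)}),
    ([7,3,6,2,4,5,1], {(1,4),(1,5),(1,6),(1,7),(2,3),(2,4),(2,5),(2,6),(2,7),(3,4),(3,6),(3,7)}, {(3,5)}),
    ([7,3,6,4,2,5,1], {(1,4),(1,5),(1,6),(1,7),(2,3),(2,4),(2,5),(2,6),(2,7),(3,4),(3,6),(3,7),
                       (4,4),(4,5),(4,6),(4,7)}, {(3,5)})
  ]"

end

theory Submission
  imports Defs
begin

text \<open>For b > a, the entry b precedes a in S(w) iff some c > b lies between b and a in w. Unfolding this
  three times, w is not sorted by S^3 iff there are entries a < b < c < d < e such that d e a
  is a subsequence of w, no x > d lies between d and c, and whenever x < y are entries above c with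
  x y b a subsequence, some z > x lies between x and c. If b precedes c the last condition is void,
  which gives patterns 1, 2, 4. If c precedes b, let f be the first entry above c between c and b.
  If there is no f, we get patterns 3 and 5. Otherwise the entries above c between c and b decrease from f;
  f < e gives pattern 6, and f > e, with d chosen maximal, gives 7 and 8 if no entry above f precedes c,
  and 9 and 10 if the last such entry is added. Conversely, an occurrence of one of the patterns 6-10
  whose c is maximal satisfies the conditions, or else there is an occurrence of 23451.\<close>

section \<open>Inversions under stack sorting\<close>

fun before :: "'a list \<Rightarrow> 'a \<Rightarrow> 'a \<Rightarrow> bool" where
  "before [] x y \<longleftrightarrow> False"
| "before (z # zs) x y \<longleftrightarrow> z = x \<and> y \<in> set zs \<or> before zs x y"

lemma before_append:
  "before (xs @ ys) x y \<longleftrightarrow> before xs x y \<or> before ys x y \<or> x \<in> set xs \<and> y \<in> set ys"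
  by (induction xs) auto

lemma before_in_set: "before w x y \<Longrightarrow> x \<in> set w \<and> y \<in> set w"
  by (induction w) auto

lemma before_iff_nth: "before w x y \<longleftrightarrow> (\<exists>i j. i < j \<and> j < length w \<and> w ! i = x \<and> w ! j = y)"
proof (induction w)
  case (Cons z zs)
  show ?case (is "?l \<longleftrightarrow> ?r")
  proof
    assume ?l
    then consider "z = x" "y \<in> set zs" | "before zs x y" by auto
    then show ?r
    proof cases
      case 1
      then obtain j where "j < length zs" "zs ! j = y" by (auto simp: in_set_conv_nth)
      then show ?thesis using 1 by (intro exI[of _ 0] exI[of _ "Suc j"]) auto
    next
      case 2
      then obtain i j where "i < j" "j < length zs" "zs ! i = x" "zs ! j = y" using Cons by auto
      then show ?thesis by (intro exI[of _ "Suc i"] exI[of _ "Suc j"]) auto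
    qed
  next
    assume ?r
    then obtain i j where ij: "i < j" "j < length (z # zs)" "(z # zs) ! i = x" "(z # zs) ! j = y"
      by blast
    then obtain j' where j': "j = Suc j'" by (cases j) auto
    show ?l
    proof (cases i)
      case 0
      then show ?thesis using ij j' by auto
    next
      case (Suc i')
      then show ?thesis using ij j' Cons by auto
    qed
  qed
qed simp

lemma stack_sort_split:
  assumes "m \<notin> set us" "\<And>x. x \<in> set us \<union> set vs \<Longrightarrow> x \<le> m"
  shows "stack_sort (us @ m # vs) = stack_sort us @ stack_sort vs @ [m]"
proof -
  obtain x xs where w: "us @ m # vs = x # xs" by (cases "us @ m # vs") auto
  have "Max (set (us @ m # vs)) = m" using assms(2) by (intro Max_eqI) auto
  then have m: "Max (set (x # xs)) = m" by (simp only: w)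
  have t: "takeWhile (\<lambda>y. y \<noteq> m) (us @ m # vs) = us"
    "dropWhile (\<lambda>y. y \<noteq> m) (us @ m # vs) = m # vs"
    using assms(1) by (auto simp: takeWhile_append dropWhile_append)
  show ?thesis
    using t unfolding w stack_sort.simps Let_def m by simp
qed

lemma split_at_Max:
  fixes w :: "nat list"
  assumes "distinct w" "w \<noteq> []"
  obtains us m vs where "w = us @ m # vs" "m \<notin> set us" "m \<notin> set vs"
    "\<And>x. x \<in> set us \<union> set vs \<Longrightarrow> x < m"
proof -
  have "Max (set w) \<in> set w" using assms by simp
  then obtain us vs where w: "w = us @ Max (set w) # vs" by (meson split_list)
  moreover have "Max (set w) \<notin> set us" "Max (set w) \<notin> set vs"
    using assms(1) w by (metis distinct_append distinct.simps(2) not_distinct_conv_prefix)+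
  moreover have "x < Max (set w)" if "x \<in> set us \<union> set vs" for x
  proof -
    have "x \<in> set w" using that by (subst w) auto
    then show ?thesis using that calculation(2,3) Max_ge[of "set w" x] by (metis List.finite_set UnE nat_less_le)
  qed
  ultimately show ?thesis using that by blast
qed

lemma set_distinct_stack_sort:
  "distinct w \<Longrightarrow> set (stack_sort w) = set w \<and> distinct (stack_sort w)"
proof (induction w rule: length_induct)
  case (1 w)
  show ?case
  proof (cases "w = []")
    case False
    then obtain us m vs where w: "w = us @ m # vs" "m \<notin> set us" "m \<notin> set vs"
      and lt: "\<And>x. x \<in> set us \<union> set vs \<Longrightarrow> x < m"
      using split_at_Max 1 by metis
    have "stack_sort w = stack_sort us @ stack_sort vs @ [m]"
      unfolding w using w lt by (intro stack_sort_split) (auto intro: less_imp_le)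
    moreover have "set (stack_sort us) = set us \<and> distinct (stack_sort us)"
      "set (stack_sort vs) = set vs \<and> distinct (stack_sort vs)"
      using 1 w by auto
    ultimately show ?thesis using w 1 by auto
  qed simp
qed

text \<open>Induction along the split at the maximum m, where S(w) is S(us), S(vs), m. If b lies in
  us and a in vs, then m is the required larger entry between them. If both lie on the same side, so
  does everything between them and the induction hypothesis applies. The entry m itself is output
  last and precedes nothing.\<close>

lemma inversion_stack_sort:
  assumes "distinct w" "a < b"
  shows "before (stack_sort w) b a \<longleftrightarrow> (\<exists>c>b. before w b c \<and> before w c a)"
  using assms(1)
proof (induction w rule: length_induct)
  case (1 w)
  show ?case
  proof (cases "w = []")
    case False
    then obtain us m vs where w: "w = us @ m # vs" "m \<notin> set us" "m \<notin> set vs"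
      and lt: "\<And>x. x \<in> set us \<union> set vs \<Longrightarrow> x < m"
      using split_at_Max 1 by metis
    have s: "stack_sort w = stack_sort us @ stack_sort vs @ [m]"
      unfolding w using w lt by (intro stack_sort_split) (auto intro: less_imp_le)
    have d: "distinct us" "distinct vs" "set us \<inter> set vs = {}" using w 1(2) by auto
    have IH: "before (stack_sort us) b a \<longleftrightarrow> (\<exists>c>b. before us b c \<and> before us c a)"
      "before (stack_sort vs) b a \<longleftrightarrow> (\<exists>c>b. before vs b c \<and> before vs c a)"
      using 1 w d by auto
    have S: "set (stack_sort us) = set us" "set (stack_sort vs) = set vs"
      using d set_distinct_stack_sort by auto
    have ma: "b \<in> set us \<union> set vs \<Longrightarrow> a \<noteq> m" using lt[of b] assms(2) by auto
    have l: "before (stack_sort w) b a \<longleftrightarrow>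
        (\<exists>c>b. before us b c \<and> before us c a) \<or> (\<exists>c>b. before vs b c \<and> before vs c a)
        \<or> b \<in> set us \<and> a \<in> set vs"
      using ma by (auto simp: s before_append S IH)
    have r: "before w x y \<longleftrightarrow> before us x y \<or> before vs x y \<or> x = m \<and> y \<in> set vs \<or> x \<in> set us \<and> y = m
        \<or> x \<in> set us \<and> y \<in> set vs" for x y
      using w by (auto simp: before_append)
    show ?thesis
    proof
      assume "before (stack_sort w) b a"
      then consider "\<exists>c>b. before us b c \<and> before us c a" | "\<exists>c>b. before vs b c \<and> before vs c a"
        | "b \<in> set us" "a \<in> set vs" using l by blast
      then show "\<exists>c>b. before w b c \<and> before w c a"
      proof cases
        case 3
        then show ?thesis using lt[of b] r by (intro exI[of _ m]) auto
      qed (use r in blast)+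
    next
      assume "\<exists>c>b. before w b c \<and> before w c a"
      then obtain c where c: "c > b" "before w b c" "before w c a" by blast
      have "b \<noteq> m"
      proof
        assume "b = m"
        then have "c \<in> set vs" using c(2) r[of b c] w before_in_set by metis
        then show False using lt[of c] c(1) \<open>b = m\<close> by auto
      qed
      moreover have "c \<in> set us \<Longrightarrow> c \<notin> set vs \<and> c \<noteq> m" "c \<in> set vs \<Longrightarrow> c \<noteq> m" using d w by auto
      moreover have "a \<in> set us \<union> set vs"
      proof -
        have "b \<in> set us \<union> set vs" using c(2) \<open>b \<noteq> m\<close> before_in_set[OF c(2)] w by auto
        then show ?thesis using ma before_in_set[OF c(3)] w by auto
      qed
      moreover have "b \<in> set us \<Longrightarrow> b \<notin> set vs" "a \<in> set us \<Longrightarrow> a \<notin> set vs"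
        "a \<in> set us \<union> set vs \<Longrightarrow> a \<noteq> m" using d w by auto
      ultimately show "before (stack_sort w) b a"
        unfolding l using c(1) c(2)[unfolded r] c(3)[unfolded r]
        using before_in_set[of us b c] before_in_set[of us c a] before_in_set[of vs b c] before_in_set[of vs c a]
        by blast
    qed
  qed simp
qed

text \<open>Positions count from 1, as in \<open>is_occurrence\<close>, so this inverts the shifted
  indexing \<open>w ! (i - 1)\<close>.\<close>

definition pos :: "'a list \<Rightarrow> 'a \<Rightarrow> nat" where
  "pos w = inv_into {1..length w} (\<lambda>i. w ! (i - 1))"

context
  fixes w :: "'a list"
  assumes dist: "distinct w"
begin

lemma set_eq_nth_image: "set w = (\<lambda>i. w ! (i - 1)) ` {1..length w}"
proof -
  have "set w = nth w ` {..<length w}" by (auto simp: in_set_conv_nth)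
  also have "{..<length w} = (\<lambda>i. i - 1) ` {1..length w}"
    by (auto intro!: image_eqI[where x = "Suc _"])
  finally show ?thesis by (simp add: image_image)
qed

lemma pos_nth: "i \<in> {1..length w} \<Longrightarrow> pos w (w ! (i - 1)) = i"
  unfolding pos_def using dist
  by (intro inv_into_f_f[where f = "\<lambda>i. w ! (i - 1)"]) (auto simp: inj_on_def nth_eq_iff_index_eq)

lemma pos_bounds: "x \<in> set w \<Longrightarrow> pos w x \<in> {1..length w}"
  unfolding pos_def set_eq_nth_image by (rule inv_into_into)

lemma nth_pos: "x \<in> set w \<Longrightarrow> w ! (pos w x - 1) = x"
  unfolding pos_def set_eq_nth_image by (rule f_inv_into_f)

lemma inj_on_pos: "inj_on (pos w) (set w)"
  by (metis inj_onI nth_pos)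

lemma before_iff_pos: "before w x y \<longleftrightarrow> x \<in> set w \<and> y \<in> set w \<and> pos w x < pos w y"
proof
  assume "before w x y"
  then obtain i j where ij: "i < j" "j < length w" "w ! i = x" "w ! j = y" using before_iff_nth by metis
  then show "x \<in> set w \<and> y \<in> set w \<and> pos w x < pos w y"
    using pos_nth[of "Suc i"] pos_nth[of "Suc j"] by auto
next
  assume "x \<in> set w \<and> y \<in> set w \<and> pos w x < pos w y"
  then show "before w x y"
    unfolding before_iff_nth using nth_pos[of x] nth_pos[of y] pos_bounds[of x] pos_bounds[of y]
    by (intro exI[of _ "pos w x - 1"] exI[of _ "pos w y - 1"]) auto
qed

lemma before_linear: "x \<in> set w \<Longrightarrow> y \<in> set w \<Longrightarrow> x \<noteq> y \<Longrightarrow> before w x y \<longleftrightarrow> \<not> before w y x"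
  unfolding before_iff_pos using inj_on_pos by (metis inj_on_def linorder_neqE_nat order_less_asym)

end

lemma sorted_iff_no_inversion: "sorted w \<longleftrightarrow> \<not> (\<exists>a b. a < b \<and> before w b a)" for w :: "nat list"
proof (induction w)
  case (Cons z zs)
  have "(\<exists>a b. a < b \<and> before (z # zs) b a) \<longleftrightarrow> (\<exists>a\<in>set zs. a < z) \<or> (\<exists>a b. a < b \<and> before zs b a)"
    by auto
  then show ?case using Cons by (auto simp: not_less)
qed simp

section \<open>Entries placed by an injective position function\<close>

locale arrangement =
  fixes A :: "nat set" and p :: "nat \<Rightarrow> nat"
  assumes inj: "inj_on p A"
begin

lemma p_eq: "x \<in> A \<Longrightarrow> y \<in> A \<Longrightarrow> p x = p y \<Longrightarrow> x = y"
  using inj by (auto simp: inj_on_def)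

text \<open>For c < d, noninv1 d c says that c precedes d after one sorting pass, and noninv2 c b (for b < c)
  that b precedes c after two passes.\<close>

definition noninv1 where "noninv1 d c \<longleftrightarrow> (\<forall>x\<in>A. d < x \<longrightarrow> \<not> (p d < p x \<and> p x < p c))"

definition noninv2 where "noninv2 c b \<longleftrightarrow>
  (\<forall>x\<in>A. \<forall>y\<in>A. c < x \<and> x < y \<and> p x < p y \<and> p y < p b \<longrightarrow> (\<exists>z\<in>A. x < z \<and> p x < p z \<and> p z < p c))"

text \<open>The inversion of b and a after three passes is witnessed by c after two passes, the
  inversion of c and a by d after one pass, and that of d and a by e in the original word. The two
  non-inversion conditions say that c precedes d after one pass and that b precedes c after
  two.\<close>

definition unsortable where "unsortable \<longleftrightarrow> (\<exists>a\<in>A. \<exists>b\<in>A. \<exists>c\<in>A. \<exists>d\<in>A. \<exists>e\<in>A.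
  a < b \<and> b < c \<and> c < d \<and> d < e \<and> p d < p e \<and> p e < p a \<and> noninv1 d c \<and> noninv2 c b)"

definition in_order where "in_order xs \<longleftrightarrow> set xs \<subseteq> A \<and> sorted_wrt (<) (map p xs)"

text \<open>Together with \<open>clear_left\<close> (for column 0) and
  \<open>decreasing_between\<close> (for the decorated region) this expresses box conditions: u and
  v bound a column, and P describes a range of values. A stack of boxes in one column thus becomes a
  single condition.\<close>

definition clear where "clear u v P \<longleftrightarrow> (\<forall>x\<in>A. p u < p x \<and> p x < p v \<longrightarrow> \<not> P x)"

definition clear_left where "clear_left v P \<longleftrightarrow> (\<forall>x\<in>A. p x < p v \<longrightarrow> \<not> P x)"

definition decreasing_between where "decreasing_between u v P \<longleftrightarrow>
  (\<forall>x\<in>A. \<forall>y\<in>A. p u < p x \<and> p x < p y \<and> p y < p v \<and> P x \<and> P y \<longrightarrow> y < x)"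

lemma unsortableI:
  assumes "{a,b,c,d,e} \<subseteq> A" "a < b" "b < c" "c < d" "d < e" "p d < p e" "p e < p a" "noninv1 d c" "noninv2 c b"
  shows unsortable
  using assms unfolding unsortable_def by (meson insert_subset)

lemma clearD: "clear u v P \<Longrightarrow> x \<in> A \<Longrightarrow> p u < p x \<Longrightarrow> p x < p v \<Longrightarrow> \<not> P x"
  by (simp add: clear_def)

lemma decreasing_betweenD:
  "decreasing_between u v P \<Longrightarrow> x \<in> A \<Longrightarrow> y \<in> A \<Longrightarrow> p u < p x \<Longrightarrow> p x < p y \<Longrightarrow> p y < p v
    \<Longrightarrow> P x \<Longrightarrow> P y \<Longrightarrow> y < x"
  by (simp add: decreasing_between_def)

text \<open>The only value above c missing on the right-hand side is d, and the second assumption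
  puts d outside the column. This merges shaded boxes that lie on top of each other.\<close>

lemma clear_above:
  assumes "c < d" "\<not> p u < p d \<or> \<not> p d < p v"
  shows "clear u v (\<lambda>x. c < x) \<longleftrightarrow> clear u v (\<lambda>x. c < x \<and> x < d) \<and> clear u v (\<lambda>x. d < x)"
proof -
  have "c < x \<longleftrightarrow> c < x \<and> x < d \<or> d < x" if "p u < p x \<and> p x < p v" for x
    using assms that by (cases x d rule: linorder_cases) auto
  then show ?thesis unfolding clear_def by blast
qed

lemma clear_split_disj: "clear u v (\<lambda>x. P x \<or> Q x) \<longleftrightarrow> clear u v P \<and> clear u v Q"
  by (auto simp: clear_def)

lemma clear_left_split:
  assumes "d < e" "e < f" "\<not> p e < p v"
  shows "clear_left v (\<lambda>x. d < x \<and> x < f) \<longleftrightarrow>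
    clear_left v (\<lambda>x. d < x \<and> x < e) \<and> clear_left v (\<lambda>x. e < x \<and> x < f)"
proof -
  have "d < x \<and> x < f \<longleftrightarrow> d < x \<and> x < e \<or> e < x \<and> x < f" if "p x < p v" for x
    using assms that by (cases x e rule: linorder_cases) auto
  then show ?thesis unfolding clear_left_def by blast
qed

text \<open>Meant for 364251 and 7364251, where d stands left of b and the shading stops at d. All
  values satisfying P exceed d, so beyond d the second \<open>clear\<close> condition excludes
  them.\<close>

lemma clear_extend:
  assumes "d \<in> A" "clear u d P" "clear d v (\<lambda>x. d < x)" "d < e" "e < f"
    "P = (\<lambda>x. d < x \<and> x < e \<or> f < x)"
  shows "clear u v P"
  unfolding clear_def
proof (intro ballI impI notI)
  fix x assume x: "x \<in> A" "p u < p x \<and> p x < p v" "P x"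
  then have "d < x" using assms by auto
  then show False
    using x clearD[OF assms(2), of x] clearD[OF assms(3), of x] p_eq[of x d] assms(1)
    by (cases "p x" "p d" rule: linorder_cases) auto
qed

text \<open>Values between e and f exceed d, so no such entry stands between d and v. A pair of them
  left of v therefore lies left of d already.\<close>

lemma decreasing_extend:
  assumes "d \<in> A" "decreasing_between u d (\<lambda>x. e < x \<and> x < f)" "clear d v (\<lambda>x. d < x)" "d < e"
  shows "decreasing_between u v (\<lambda>x. e < x \<and> x < f)"
  unfolding decreasing_between_def
proof (intro ballI impI)
  fix x y
  assume xy: "x \<in> A" "y \<in> A" "p u < p x \<and> p x < p y \<and> p y < p v \<and> (e < x \<and> x < f) \<and> e < y \<and> y < f"
  then have "\<not> p d < p y" using clearD[OF assms(3), of y] assms(4) by auto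
  moreover have "p y \<noteq> p d" using p_eq[of y d] xy assms by auto
  ultimately show "y < x" using decreasing_betweenD[OF assms(2), of x y] xy by auto
qed

text \<open>The entry y itself serves as z: it precedes b and hence c.\<close>

lemma noninv2_if_before: "p b < p c \<Longrightarrow> noninv2 c b"
  unfolding noninv2_def by (meson order.strict_trans)

text \<open>For an ascent x, y before b there are three cases. Both right of c contradicts
  \<open>dec\<close>; if y is left of c, then z = y works; if c separates them, then y is at most f
  by \<open>le\<close>, so x < f and \<open>left\<close> supplies z.\<close>

lemma noninv2I:
  assumes "c \<in> A" and dec: "decreasing_between c b (\<lambda>x. c < x)" and le: "clear c b (\<lambda>x. f < x)"
    and left: "\<And>x. x \<in> A \<Longrightarrow> p x < p c \<Longrightarrow> c < x \<Longrightarrow> x < f \<Longrightarrow> \<exists>z\<in>A. x < z \<and> p x < p z \<and> p z < p c"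
  shows "noninv2 c b"
  unfolding noninv2_def
proof (intro ballI impI)
  fix x y
  assume xy: "x \<in> A" "y \<in> A" and h: "c < x \<and> x < y \<and> p x < p y \<and> p y < p b"
  have "p x \<noteq> p c" "p y \<noteq> p c" using p_eq[of x c] p_eq[of y c] xy h assms(1) by auto
  then consider "p c < p x" | "p x < p c" "p y < p c" | "p x < p c" "p c < p y" by linarith
  then show "\<exists>z\<in>A. x < z \<and> p x < p z \<and> p z < p c"
  proof cases
    case 1
    then show ?thesis using dec xy h unfolding decreasing_between_def by (metis order.strict_trans order_less_asym)
  next
    case 2
    then show ?thesis using xy h by blast
  next
    case 3
    then have "y \<le> f" using le xy h unfolding clear_def by force
    then show ?thesis using left[of x] xy h 3 by auto
  qed
qed

lemma noninv2_if_clear: "c \<in> A \<Longrightarrow> clear c b (\<lambda>x. c < x) \<Longrightarrow> noninv2 c b"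
  \<comment> \<open>With the bound f = c, the condition on entries left of c is vacuous.\<close>
  by (rule noninv2I[where f = c]) (auto simp: clear_def decreasing_between_def)

lemma noninv1_if_before: "p c < p d \<Longrightarrow> noninv1 d c"
  unfolding noninv1_def by auto

section \<open>Configurations that force unsortability\<close>

lemma unsortable_23451:
  assumes "a < b" "b < c" "c < d" "d < e" "in_order [b,c,d,e,a]"
  shows unsortable
  using assms by (intro unsortableI[of a b c d e] noninv1_if_before noninv2_if_before) (auto simp: in_order_def)

text \<open>Raising c while keeping the other four entries reaches an occurrence that satisfies noninv2.\<close>

lemma unsortable_34251:
  assumes "a < b" "b < c" "c < d" "d < e" "in_order [c,d,b,e,a]"
    and "clear c d (\<lambda>x. c < x)" "clear d b (\<lambda>x. d < x)"
  shows unsortable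
  using assms
proof (induction "d - c" arbitrary: c rule: less_induct)
  case less
  note ord = less.prems(1-4) and cl = less.prems(6,7)
  have A: "a \<in> A" "b \<in> A" "c \<in> A" "d \<in> A" "e \<in> A"
    and p: "p c < p d" "p d < p b" "p b < p e" "p e < p a"
    using less.prems(5) by (auto simp: in_order_def)
  show ?case
  proof (cases "noninv2 c b")
    case True
    then show ?thesis using A p ord by (intro unsortableI[of a b c d e] noninv1_if_before) auto
  next
    case False
    have after_d: "p d < p x" if "x \<in> A" "p c < p x" "c < x" "x \<noteq> d" for x
      using that cl(1) p_eq[of x d] A(4) unfolding clear_def by (metis linorder_neqE_nat)
    have le: "clear c b (\<lambda>x. d < x)"
      using after_d cl(2) ord(3) unfolding clear_def by (metis order.strict_trans nat_neq_iff)
    \<comment> \<open>These are the two ways in which \<open>noninv2I\<close>, with bound d, can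
      fail to apply.\<close>
    consider "\<not> decreasing_between c b (\<lambda>x. c < x)"
      | x where "x \<in> A" "p x < p c" "c < x" "x < d" "\<And>z. z \<in> A \<Longrightarrow> x < z \<Longrightarrow> p x < p z \<Longrightarrow> \<not> p z < p c"
      using noninv2I[OF A(3) _ le] False by blast
    then show ?thesis
    proof cases
      \<comment> \<open>An ascent x, y above c between c and b has y <= d < e, so c, x, y, e, a form
        an occurrence of 23451.\<close>
      case 1
      then obtain x y where xy: "x \<in> A" "y \<in> A" "p c < p x" "p x < p y" "p y < p b" "c < x" "c < y" "\<not> y < x"
        unfolding decreasing_between_def by blast
      then have "x < y" by (metis nat_neq_iff)
      have "y \<le> d" using le xy p unfolding clear_def by force
      then show ?thesis
        using xy A p ord \<open>x < y\<close>
        by (intro unsortable_23451[of a c x y e]) (auto simp: in_order_def)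
    next
      \<comment> \<open>Now x takes the role of c, which shrinks d - c. An entry above x between x
        and d cannot precede c by the choice of x, and cannot follow c because the column from c to
        d is clear.\<close>
      case (2 x)
      have "clear x d (\<lambda>y. x < y)"
        unfolding clear_def
      proof (intro ballI impI notI)
        fix y assume y: "y \<in> A" "p x < p y \<and> p y < p d" "x < y"
        then have "p c < p y" using 2(5)[of y] p_eq[of y c] A(3) 2(3) by (metis linorder_neqE_nat order_less_asym)
        then show False using cl(1) y 2(3) unfolding clear_def by auto
      qed
      then show ?thesis
        using 2 ord A p cl(2) by (intro less.hyps[of x]) (auto simp: in_order_def)
    qed
  qed
qed

text \<open>Common weakening of the four patterns with a decorated region; f is the largest entry between
  c and b, and again raising c (possibly together with a new choice of f) leads to noninv2.\<close>

lemma unsortable_decorated: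
  assumes "a < b" "b < c" "c < d" "d < e" "e < f" "in_order [c,f,b,e,a]" "d \<in> A" "p c < p d" "p d < p e"
    and "\<And>x. x \<in> A \<Longrightarrow> p x < p c \<Longrightarrow> d < x \<Longrightarrow> x < f \<Longrightarrow> \<exists>g\<in>A. f < g \<and> p x < p g \<and> p g < p c"
    and "clear c f (\<lambda>x. c < x)" "clear f b (\<lambda>x. d < x \<and> x < e \<or> f < x)"
    and "decreasing_between f b (\<lambda>x. e < x \<and> x < f)" "clear d b (\<lambda>x. d < x)"
  shows unsortable
  using assms
proof (induction "d - c" arbitrary: c f rule: less_induct)
  case less
  note ord = less.prems(1-5) and left = less.prems(10) and cl = less.prems(11,12,14) and dec = less.prems(13)
  have A: "a \<in> A" "b \<in> A" "c \<in> A" "d \<in> A" "e \<in> A" "f \<in> A"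
    and p: "p c < p f" "p f < p b" "p b < p e" "p e < p a" "p c < p d" "p d < p e"
    using less.prems(6-9) by (auto simp: in_order_def)
  have after_f: "p f < p x" if "x \<in> A" "p c < p x" "c < x" "x \<noteq> f" for x
    using that cl(1) p_eq[of x f] A(6) unfolding clear_def by (metis linorder_neqE_nat)
  have le: "clear c b (\<lambda>x. f < x)"
    using after_f cl(2) ord unfolding clear_def by (metis order.strict_trans nat_neq_iff)
  show ?case
  proof (cases "noninv2 c b")
    case True
    then show ?thesis using A p ord by (intro unsortableI[of a b c d e] noninv1_if_before) auto
  next
    case False
    consider "\<not> decreasing_between c b (\<lambda>x. c < x)"
      | x where "x \<in> A" "p x < p c" "c < x" "x < f" "\<And>z. z \<in> A \<Longrightarrow> x < z \<Longrightarrow> p x < p z \<Longrightarrow> \<not> p z < p c"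
      using noninv2I[OF A(3) _ le] False by blast
    then show ?thesis
    proof cases
      case 1
      \<comment> \<open>Among the ascents above c between c and b, one with the least distance of
        positions is chosen. It then has no entry above x between x and y, which is the shading
        needed once x replaces c and y replaces f.\<close>
      define Q where "Q = (\<lambda>x y. x \<in> A \<and> y \<in> A \<and> p c < p x \<and> p x < p y \<and> p y < p b \<and> c < x \<and> x < y)"
      have "\<exists>x y. Q x y"
      proof -
        obtain x y where "x \<in> A" "y \<in> A" "p c < p x" "p x < p y" "p y < p b" "c < x" "c < y" "\<not> y < x"
          using 1 unfolding decreasing_between_def by blast
        moreover then have "x < y" by (metis nat_neq_iff)
        ultimately show ?thesis unfolding Q_def by blast
      qed
      then obtain n where n: "\<exists>x y. Q x y \<and> p y - p x = n" "\<And>m. m < n \<Longrightarrow> \<not> (\<exists>x y. Q x y \<and> p y - p x = m)"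
        using exists_least_iff[of "\<lambda>n. \<exists>x y. Q x y \<and> p y - p x = n"] by blast
      then obtain x y where Qxy: "Q x y" and least: "\<And>x' y'. Q x' y' \<Longrightarrow> p y - p x \<le> p y' - p x'"
        by (metis not_less)
      then have xy: "x \<in> A" "y \<in> A" "p c < p x" "p x < p y" "p y < p b" "c < x" "x < y"
        unfolding Q_def by auto
      have adj: "clear x y (\<lambda>z. x < z)"
        unfolding clear_def
      proof (intro ballI impI notI)
        fix z assume z: "z \<in> A" "p x < p z \<and> p z < p y" "x < z"
        then have "Q x z" using xy unfolding Q_def by auto
        then show False using least[of x z] z by linarith
      qed
      \<comment> \<open>Nothing above c stands between c and f, whereas x precedes y; so y is not f,
        and x comes after f.\<close>
      have "y \<noteq> f" using after_f[of x] xy by auto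
      have yf: "y < f" using le xy p \<open>y \<noteq> f\<close> unfolding clear_def by force
      have xf: "p f < p x" using after_f[of x] xy yf by auto
      have "y \<noteq> e" using xy p by auto
      then consider "y < e" | "e < y" by linarith
      then show ?thesis
      proof cases
        case 1
        then show ?thesis
          using xy A p ord by (intro unsortable_23451[of a c x y e]) (auto simp: in_order_def)
      next
        case 2
        \<comment> \<open>Otherwise x = d contradicts the shading between d and b, a value between d
          and e contradicts the shading between f and b, and x > e makes x, y an ascent inside the
          decorated region.\<close>
        have "x < d"
        proof (rule ccontr)
          assume "\<not> x < d"
          moreover have "x \<noteq> d" using cl(3) xy 2 ord unfolding clear_def by auto
          moreover have "x \<noteq> e" using xy p by auto
          ultimately have "e < x"
            using clearD[OF cl(2), of x] xy xf by force
          then show False using decreasing_betweenD[OF dec, of x y] xy xf yf 2 by auto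
        qed
        \<comment> \<open>Between d and b nothing exceeds d, so y stands left of d. Hence so does x,
          as required of the new c.\<close>
        have yd: "p y < p d"
        proof (rule ccontr)
          assume "\<not> p y < p d"
          moreover have "p y \<noteq> p d" using p_eq[of y d] xy A(4) 2 ord by auto
          ultimately show False using clearD[OF cl(3), of y] xy 2 ord by auto
        qed
        show ?thesis
        proof (rule less.hyps[of x y])
          \<comment> \<open>Such a z must precede c: to the right of c it would come after f, and
            there it is either shaded or forms an ascent with y in the decorated region. The old
            \<open>left\<close> condition then yields g > f > y.\<close>
          fix z assume z: "z \<in> A" "p z < p x" "d < z" "z < y"
          have "p z \<noteq> p c" using p_eq[of z c] z A(3) ord by auto
          have "p z < p c"
          proof (rule ccontr)
            assume "\<not> p z < p c"
            then have "p f < p z" using after_f[of z] z \<open>p z \<noteq> p c\<close> ord yf by auto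
            moreover have "z \<noteq> e" using z xy p by auto
            ultimately show False
              using clearD[OF cl(2), of z] decreasing_betweenD[OF dec, of z y] z xy yf 2 by force
          qed
          then obtain g where "g \<in> A" "f < g" "p z < p g" "p g < p c" using left[of z] z yf by auto
          then show "\<exists>g\<in>A. y < g \<and> p z < p g \<and> p g < p x" using yf xy by (intro bexI[of _ g]) auto
        next
          show "clear y b (\<lambda>z. d < z \<and> z < e \<or> y < z)"
            unfolding clear_def
          proof (intro ballI impI notI)
            fix z assume z: "z \<in> A" "p y < p z \<and> p z < p b" "d < z \<and> z < e \<or> y < z"
            have "p f < p z" using z xy xf by linarith
            then have "\<not> (d < z \<and> z < e)" "\<not> f < z" using cl(2) z unfolding clear_def by auto
            moreover have "z \<noteq> f" using \<open>p f < p z\<close> by auto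
            ultimately have "y < z" "z < f" using z by auto
            then show False using decreasing_betweenD[OF dec, of y z] z xy xf yf 2 by auto
          qed
        next
          show "decreasing_between y b (\<lambda>z. e < z \<and> z < y)"
            unfolding decreasing_between_def
          proof (intro ballI impI)
            fix u v
            assume "u \<in> A" "v \<in> A" "p y < p u \<and> p u < p v \<and> p v < p b \<and> (e < u \<and> u < y) \<and> e < v \<and> v < y"
            then show "v < u" using decreasing_betweenD[OF dec, of u v] xy xf yf by auto
          qed
        qed (use xy A p ord cl(3) adj yd \<open>x < d\<close> 2 in \<open>auto simp: in_order_def\<close>)
      qed
    next
      case (2 x)
      \<comment> \<open>For x > d the \<open>left\<close> condition would give an entry above f, and
        so above x, between x and c, against the choice of x.\<close>
      have "x < d"
      proof (rule ccontr)
        assume "\<not> x < d"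
        moreover have "x \<noteq> d" using 2 p by auto
        ultimately obtain g where "g \<in> A" "f < g" "p x < p g" "p g < p c" using left[of x] 2 by auto
        then show False using 2(4) 2(5)[of g] by auto
      qed
      show ?thesis
      proof (rule less.hyps[of x f])
        \<comment> \<open>The entry g belonging to z exceeds x, so it cannot lie between x and c and
          must precede x.\<close>
        fix z assume z: "z \<in> A" "p z < p x" "d < z" "z < f"
        then obtain g where g: "g \<in> A" "f < g" "p z < p g" "p g < p c" using left[of z] 2 by auto
        then have "\<not> p x < p g" using 2(4) 2(5)[of g] by auto
        moreover have "p g \<noteq> p x" using p_eq[of g x] g 2 by auto
        ultimately show "\<exists>g\<in>A. f < g \<and> p z < p g \<and> p g < p x" using g by auto
      next
        show "clear x f (\<lambda>y. x < y)"
          unfolding clear_def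
        proof (intro ballI impI notI)
          fix y assume y: "y \<in> A" "p x < p y \<and> p y < p f" "x < y"
          then have "p c < p y" using 2(5)[of y] p_eq[of y c] A(3) 2(3) by (metis linorder_neqE_nat order_less_asym)
          then show False using cl(1) y 2(3) unfolding clear_def by auto
        qed
      qed (use 2 A p ord cl dec \<open>x < d\<close> in \<open>auto simp: in_order_def\<close>)
    qed
  qed
qed

end

section \<open>Unfolding three sorting passes\<close>

lemma unsorted_iff:
  assumes dw: "distinct w"
  shows "\<not> sorted ((stack_sort ^^ 3) w) \<longleftrightarrow> arrangement.unsortable (set w) (pos w)"
proof -
  interpret arrangement "set w" "pos w" using inj_on_pos[OF dw] by unfold_locales
  define w1 where "w1 = stack_sort w"
  define w2 where "w2 = stack_sort w1"
  have d1: "distinct w1" "set w1 = set w" and d2: "distinct w2" "set w2 = set w"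
    using set_distinct_stack_sort dw unfolding w1_def w2_def by auto
  have noninv1: "before w1 c d \<longleftrightarrow> noninv1 d c" if "c \<in> set w" "d \<in> set w" "c < d" for c d
  proof -
    \<comment> \<open>Only a larger entry preceding a smaller one can be unfolded by
      \<open>inversion_stack_sort\<close>. A pair in increasing order is therefore expressed as the
      absence of the reverse order.\<close>
    have "before w1 c d \<longleftrightarrow> \<not> before w1 d c" using that before_linear[of w1 c d] d1 by auto
    also have "\<dots> \<longleftrightarrow> noninv1 d c"
      unfolding w1_def inversion_stack_sort[OF dw \<open>c < d\<close>] noninv1_def before_iff_pos[OF dw] using that by blast
    finally show ?thesis .
  qed
  have I1: "before w1 d a \<longleftrightarrow> (\<exists>e\<in>set w. d < e \<and> pos w d < pos w e \<and> pos w e < pos w a)"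
    if "a \<in> set w" "d \<in> set w" "a < d" for a d
    unfolding w1_def inversion_stack_sort[OF dw \<open>a < d\<close>] before_iff_pos[OF dw] using that by blast
  have noninv2: "before w2 b c \<longleftrightarrow> noninv2 c b" if "b \<in> set w" "c \<in> set w" "b < c" for b c
  proof -
    have "before w2 b c \<longleftrightarrow> \<not> before w2 c b" using that before_linear[of w2 b c] d2 by auto
    also have "\<dots> \<longleftrightarrow> \<not> (\<exists>x\<in>set w. c < x \<and> before w1 c x \<and> before w1 x b)"
      unfolding w2_def inversion_stack_sort[OF d1(1) \<open>b < c\<close>] using before_in_set d1(2) by metis
    also have "\<dots> \<longleftrightarrow> \<not> (\<exists>x\<in>set w. c < x \<and> noninv1 x c \<and>
        (\<exists>y\<in>set w. x < y \<and> pos w x < pos w y \<and> pos w y < pos w b))"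
      using that by (intro arg_cong[where f = Not] bex_cong conj_cong refl noninv1 I1) auto
    \<comment> \<open>Every x that has a larger y between it and b must violate
      \<open>noninv1 x c\<close>; the violating entry is the z of \<open>noninv2\<close>.\<close>
    also have "\<dots> \<longleftrightarrow> noninv2 c b" unfolding noninv2_def noninv1_def by blast
    finally show ?thesis .
  qed
  have I2: "before w2 c a \<longleftrightarrow> (\<exists>d\<in>set w. c < d \<and> noninv1 d c \<and>
       (\<exists>e\<in>set w. d < e \<and> pos w d < pos w e \<and> pos w e < pos w a))"
    if "a \<in> set w" "c \<in> set w" "a < c" for a c
  proof -
    have "before w2 c a \<longleftrightarrow> (\<exists>d\<in>set w. c < d \<and> before w1 c d \<and> before w1 d a)"
      unfolding w2_def inversion_stack_sort[OF d1(1) \<open>a < c\<close>] using before_in_set d1(2) by metis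
    also have "\<dots> \<longleftrightarrow> (\<exists>d\<in>set w. c < d \<and> noninv1 d c \<and>
       (\<exists>e\<in>set w. d < e \<and> pos w d < pos w e \<and> pos w e < pos w a))"
      using that by (intro bex_cong conj_cong refl noninv1 I1) auto
    finally show ?thesis .
  qed
  have "(stack_sort ^^ 3) w = stack_sort w2" by (simp add: numeral_3_eq_3 w1_def w2_def)
  then have "\<not> sorted ((stack_sort ^^ 3) w) \<longleftrightarrow> (\<exists>a b. a < b \<and> (\<exists>c>b. before w2 b c \<and> before w2 c a))"
    using sorted_iff_no_inversion inversion_stack_sort[OF d2(1)] by metis
  also have "\<dots> \<longleftrightarrow> (\<exists>a\<in>set w. \<exists>b\<in>set w. \<exists>c\<in>set w. a < b \<and> b < c \<and> before w2 b c \<and> before w2 c a)"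
    using before_in_set[of w2] d2(2) by blast
  also have "\<dots> \<longleftrightarrow> (\<exists>a\<in>set w. \<exists>b\<in>set w. \<exists>c\<in>set w. a < b \<and> b < c \<and> noninv2 c b \<and>
       (\<exists>d\<in>set w. c < d \<and> noninv1 d c \<and> (\<exists>e\<in>set w. d < e \<and> pos w d < pos w e \<and> pos w e < pos w a)))"
    by (intro bex_cong conj_cong refl noninv2 I2) auto
  also have "\<dots> \<longleftrightarrow> unsortable" unfolding unsortable_def by blast
  finally show ?thesis .
qed

section \<open>Pattern occurrences described by values\<close>

text \<open>The boxes of an occurrence given by its increasing list of values; the outer boundaries
  at 0 and n + 1 impose no condition on entries.\<close>

definition cell :: "nat list \<Rightarrow> nat list \<Rightarrow> nat list \<Rightarrow> nat \<times> nat \<Rightarrow> nat \<Rightarrow> bool" where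
  "cell w q vs ab x \<longleftrightarrow>
     (fst ab \<noteq> 0 \<longrightarrow> pos w (vs ! (q ! (fst ab - 1) - 1)) < pos w x) \<and>
     (fst ab < length q \<longrightarrow> pos w x < pos w (vs ! (q ! fst ab - 1))) \<and>
     (snd ab \<noteq> 0 \<longrightarrow> vs ! (snd ab - 1) < x) \<and> (snd ab < length q \<longrightarrow> x < vs ! snd ab)"

text \<open>Since an occurrence is indexed by its increasing values rather than its positions, being
  order-isomorphic to q reduces to the positions increasing along q.\<close>

definition occurs_at :: "nat list \<Rightarrow> dpattern \<Rightarrow> nat list \<Rightarrow> bool" where
  "occurs_at w P vs \<longleftrightarrow> (case P of (q, R, D) \<Rightarrow>
     length vs = length q \<and> sorted_wrt (<) vs \<and> set vs \<subseteq> set w \<and>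
     sorted_wrt (<) (map (\<lambda>r. pos w (vs ! (r - 1))) q) \<and>
     (\<forall>ab\<in>R. \<forall>x\<in>set w. \<not> cell w q vs ab x) \<and>
     (\<forall>x\<in>set w. \<forall>y\<in>set w. pos w x < pos w y \<and> (\<exists>ab\<in>D. cell w q vs ab x) \<and> (\<exists>ab\<in>D. cell w q vs ab y)
        \<longrightarrow> y < x))"

lemma occurrence_of_values:
  assumes w: "is_perm w" and q: "is_perm q" and len: "length vs = length q"
    and vs: "sorted_wrt (<) vs" "set vs \<subseteq> set w"
    and RD: "\<And>ab. ab \<in> R \<union> D \<Longrightarrow> fst ab \<le> length q \<and> snd ab \<le> length q"
  shows "is_occurrence (q, R, D) w (map (\<lambda>r. pos w (vs ! (r - 1))) q) \<longleftrightarrow> occurs_at w (q, R, D) vs"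
proof -
  define ps where "ps = map (\<lambda>r. pos w (vs ! (r - 1))) q"
  have dw: "distinct w" "set w = {1..length w}" and dq: "distinct q" "set q = {1..length q}"
    using w q by (auto simp: is_perm_def)
  have qb: "q ! j \<in> {1..length q}" if "j < length q" for j using that dq(2) nth_mem by blast
  have vin: "vs ! (q ! j - 1) \<in> set w" if "j < length q" for j
  proof -
    have "q ! j - 1 < length vs" using qb[OF that] len by auto
    then show ?thesis using vs(2) nth_mem by blast
  qed
  have W: "w ! (ps ! j - 1) = vs ! (q ! j - 1)" if "j < length q" for j
    using that vin nth_pos[OF dw(1)] by (simp add: ps_def)
  have lps: "length ps = length q" by (simp add: ps_def)
  have "set (map (\<lambda>i. w ! (i - 1)) ps) = (\<lambda>j. vs ! (q ! j - 1)) ` {..<length q}"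
    using W lps by (force simp: in_set_conv_nth image_iff)
  also have "\<dots> = (\<lambda>r. vs ! (r - 1)) ` set q" by (force simp: in_set_conv_nth image_iff)
  also have "\<dots> = set vs"
    unfolding dq(2) len[symmetric] using set_eq_nth_image[of vs] vs(1) by (simp add: strict_sorted_iff)
  finally have setW: "set (map (\<lambda>i. w ! (i - 1)) ps) = set vs" .
  \<comment> \<open>The values of the occurrence are those of vs, and there are no repetitions
    because the set has as many elements as the list is long. So the row boundaries of
    \<open>occ_val\<close> are the entries of vs.\<close>
  have srt: "sort (map (\<lambda>i. w ! (i - 1)) ps) = vs"
  proof (rule sorted_distinct_set_unique)
    have "card (set (map (\<lambda>i. w ! (i - 1)) ps)) = length (map (\<lambda>i. w ! (i - 1)) ps)"
      unfolding setW using vs(1) len lps by (simp add: distinct_card strict_sorted_iff)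
    then show "distinct (sort (map (\<lambda>i. w ! (i - 1)) ps))" by (simp add: card_distinct)
  qed (use vs(1) setW in \<open>auto simp: strict_sorted_iff\<close>)
  \<comment> \<open>As w is a permutation, its values and positions lie in 1..n, so the boundaries
    at 0 and n + 1 hold automatically.\<close>
  have box: "in_box w ps ab i \<longleftrightarrow> i \<in> {1..length w} \<and> cell w q vs ab (w ! (i - 1))"
    if ab: "fst ab \<le> length q \<and> snd ab \<le> length q" for ab i
  proof (cases "i \<in> {1..length w}")
    case True
    then have i: "w ! (i - 1) \<in> set w" "pos w (w ! (i - 1)) = i"
      using pos_nth[OF dw(1)] by auto
    then have "1 \<le> w ! (i - 1)" "w ! (i - 1) \<le> length w" using dw(2) by auto
    then show ?thesis
      using True ab i len lps unfolding in_box_def cell_def occ_pos_def occ_val_def srt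
      by (auto simp: ps_def Suc_le_eq)
  qed (auto simp: in_box_def)
  have iso: "w ! (ps ! i - 1) < w ! (ps ! j - 1) \<longleftrightarrow> q ! i < q ! j" if "i < length q" "j < length q" for i j
  proof -
    have "sorted_wrt (<) vs" by fact
    then have "vs ! a < vs ! b \<longleftrightarrow> a < b" if "a < length vs" "b < length vs" for a b
      using that by (metis sorted_wrt_nth_less linorder_neqE_nat order_less_asym order_less_irrefl)
    then show ?thesis
      unfolding W[OF that(1)] W[OF that(2)] using qb[OF that(1)] qb[OF that(2)] len by auto
  qed
  have sub: "set ps \<subseteq> {1..length w}"
    using vin pos_bounds[OF dw(1)] by (fastforce simp: ps_def in_set_conv_nth)
  have R: "(\<forall>ab\<in>R. \<forall>x. \<not> in_box w ps ab x) \<longleftrightarrow> (\<forall>ab\<in>R. \<forall>x\<in>set w. \<not> cell w q vs ab x)"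
  proof -
    have "(\<forall>x. \<not> in_box w ps ab x) \<longleftrightarrow> (\<forall>x\<in>set w. \<not> cell w q vs ab x)" if "ab \<in> R" for ab
      using RD[of ab] that by (auto simp: box set_eq_nth_image[OF dw(1)])
    then show ?thesis by blast
  qed
  have D: "(\<exists>ab\<in>D. in_box w ps ab i) \<longleftrightarrow> i \<in> {1..length w} \<and> (\<exists>ab\<in>D. cell w q vs ab (w ! (i - 1)))" for i
    using box RD by blast
  have D': "(\<forall>x y. x < y \<and> (\<exists>ab \<in> D. in_box w ps ab x) \<and> (\<exists>ab \<in> D. in_box w ps ab y)
             \<longrightarrow> w ! (x - 1) > w ! (y - 1)) \<longleftrightarrow>
     (\<forall>x\<in>set w. \<forall>y\<in>set w. pos w x < pos w y \<and> (\<exists>ab\<in>D. cell w q vs ab x) \<and> (\<exists>ab\<in>D. cell w q vs ab y)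
        \<longrightarrow> y < x)" (is "?l \<longleftrightarrow> ?r")
  proof
    assume l: ?l
    show ?r
    proof (intro ballI impI)
      fix x y
      assume "x \<in> set w" "y \<in> set w"
        and "pos w x < pos w y \<and> (\<exists>ab\<in>D. cell w q vs ab x) \<and> (\<exists>ab\<in>D. cell w q vs ab y)"
      then show "y < x"
        using l[rule_format, of "pos w x" "pos w y"] pos_bounds[OF dw(1)] nth_pos[OF dw(1)] unfolding D by auto
    qed
  next
    assume r: ?r
    show ?l
    proof (intro allI impI)
      fix i j
      assume "i < j \<and> (\<exists>ab \<in> D. in_box w ps ab i) \<and> (\<exists>ab \<in> D. in_box w ps ab j)"
      then show "w ! (i - 1) > w ! (j - 1)"
        using r[rule_format, of "w ! (i - 1)" "w ! (j - 1)"] pos_nth[OF dw(1)] unfolding D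
        by (auto simp: nth_mem)
    qed
  qed
  show ?thesis
    unfolding is_occurrence_def occurs_at_def ps_def[symmetric] Let_def fst_conv snd_conv prod.case R D'
    using len lps vs sub iso by auto
qed

lemma contains_pat_iff:
  assumes w: "is_perm w" and q: "is_perm q"
    and RD: "\<And>ab. ab \<in> R \<union> D \<Longrightarrow> fst ab \<le> length q \<and> snd ab \<le> length q"
  shows "contains_pat w (q, R, D) \<longleftrightarrow> (\<exists>vs. occurs_at w (q, R, D) vs)"
proof
  assume "contains_pat w (q, R, D)"
  then obtain ps where ps: "is_occurrence (q, R, D) w ps" by (auto simp: contains_pat_def)
  have dw: "distinct w" "set w = {1..length w}" and dq: "distinct q" "set q = {1..length q}"
    using w q by (auto simp: is_perm_def)
  have lps: "length ps = length q" and sub: "set ps \<subseteq> {1..length w}"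
    and iso: "\<And>i j. i < length q \<Longrightarrow> j < length q \<Longrightarrow>
        w ! (ps ! i - 1) < w ! (ps ! j - 1) \<longleftrightarrow> q ! i < q ! j"
    using ps by (auto simp: is_occurrence_def Let_def)
  \<comment> \<open>The values of the occurrence are listed by pattern rank: \<open>pos q r\<close>
    is the place in the pattern where the value r stands.\<close>
  define vs where "vs = map (\<lambda>r. w ! (ps ! (pos q r - 1) - 1)) [1..<Suc (length q)]"
  have len: "length vs = length q" by (simp add: vs_def del: upt_Suc)
  have nth_vs: "vs ! r = w ! (ps ! (pos q (Suc r) - 1) - 1)" if "r < length q" for r
    using that by (simp add: vs_def del: upt_Suc)
  have pq: "pos q (Suc r) - 1 < length q" "q ! (pos q (Suc r) - 1) = Suc r" if "r < length q" for r
    using that dq(2) pos_bounds[OF dq(1), of "Suc r"] nth_pos[OF dq(1), of "Suc r"] by auto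
  have psb: "ps ! j \<in> {1..length w}" if "j < length q" for j
    using that sub lps nth_mem[of j ps] by (metis subsetD)
  have "sorted_wrt (<) vs"
    unfolding sorted_wrt_iff_nth_less using iso pq nth_vs len by simp
  moreover have "set vs \<subseteq> set w"
  proof
    fix x assume "x \<in> set vs"
    then obtain r where r: "r < length q" "x = vs ! r" using len by (auto simp: in_set_conv_nth)
    then have "ps ! (pos q (Suc r) - 1) - 1 < length w" using psb[OF pq(1)[OF r(1)]] by auto
    then show "x \<in> set w" using r nth_vs nth_mem by metis
  qed
  moreover have "ps = map (\<lambda>r. pos w (vs ! (r - 1))) q"
  proof (rule nth_equalityI)
    fix j assume j: "j < length ps"
    then have qj: "q ! j \<in> {1..length q}" using lps dq(2) nth_mem by metis
    then have "vs ! (q ! j - 1) = w ! (ps ! (pos q (q ! j) - 1) - 1)" using nth_vs[of "q ! j - 1"] by auto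
    also have "pos q (q ! j) = Suc j" using pos_nth[OF dq(1), of "Suc j"] j lps by simp
    finally show "ps ! j = map (\<lambda>r. pos w (vs ! (r - 1))) q ! j"
      using j lps pos_nth[OF dw(1) psb] by simp
  qed (simp add: lps)
  ultimately show "\<exists>vs. occurs_at w (q, R, D) vs" using occurrence_of_values[OF w q len _ _ RD] ps by metis
next
  assume "\<exists>vs. occurs_at w (q, R, D) vs"
  then obtain vs where "occurs_at w (q, R, D) vs" by blast
  then show "contains_pat w (q, R, D)"
    using occurrence_of_values[OF w q _ _ _ RD, of vs] unfolding contains_pat_def occurs_at_def by blast
qed

section \<open>The ten patterns\<close>

text \<open>Index i holds the pattern numbered i + 1 in the theorem.\<close>

lemma west3_nth:
  shows "west3_patterns ! 0 = ([2,3,4,5,1], {}, {})"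
    and "west3_patterns ! 1 = ([2,4,3,5,1], {(2,4),(2,5)}, {})"
    and "west3_patterns ! 2 = ([3,2,4,5,1], {(1,3),(1,4),(1,5)}, {})"
    and "west3_patterns ! 3 = ([4,2,3,5,1], {(1,4),(1,5),(2,4),(2,5)}, {})"
    and "west3_patterns ! 4 = ([4,3,2,5,1], {(1,4),(1,5),(2,3),(2,4),(2,5)}, {})"
    and "west3_patterns ! 5 = ([3,4,2,5,1], {(1,3),(1,4),(1,5),(2,4),(2,5)}, {})"
    and "west3_patterns ! 6 = ([3,6,2,4,5,1], {(0,4),(0,5),(1,3),(1,4),(1,5),(1,6),(2,4),(2,6)}, {(2,5)})"
    and "west3_patterns ! 7 = ([3,6,4,2,5,1], {(0,4),(0,5),(1,3),(1,4),(1,5),(1,6),(2,4),(2,6),(3,4),(3,5),(3,6)}, {(2,5)})"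
    and "west3_patterns ! 8 = ([7,3,6,2,4,5,1], {(1,4),(1,5),(1,6),(1,7),(2,3),(2,4),(2,5),(2,6),(2,7),(3,4),(3,6),(3,7)}, {(3,5)})"
    and "west3_patterns ! 9 = ([7,3,6,4,2,5,1], {(1,4),(1,5),(1,6),(1,7),(2,3),(2,4),(2,5),(2,6),(2,7),(3,4),(3,6),(3,7),
                       (4,4),(4,5),(4,6),(4,7)}, {(3,5)})"
  by (simp_all add: west3_patterns_def)

text \<open>The three groups are the patterns of length 5, 6 and 7, so the group determines the
  length of an occurrence.\<close>

lemma in_west3_iff: "P \<in> set west3_patterns \<longleftrightarrow>
    P \<in> {west3_patterns ! 0, west3_patterns ! 1, west3_patterns ! 2, west3_patterns ! 3,
      west3_patterns ! 4, west3_patterns ! 5} \<or>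
    P \<in> {west3_patterns ! 6, west3_patterns ! 7} \<or> P \<in> {west3_patterns ! 8, west3_patterns ! 9}"
  unfolding west3_nth by (simp add: west3_patterns_def)

section \<open>Boxes of the ten patterns as conditions on entries\<close>

context
  fixes w :: "nat list"
  assumes perm: "is_perm w"
begin

interpretation arrangement "set w" "pos w"
  by (unfold_locales, rule inj_on_pos) (use perm in \<open>simp add: is_perm_def\<close>)

text \<open>The three equations cover every kind of shaded box in the ten patterns: an inner column
  with an inner row, an inner column with the top row, and column 0 with an inner row.\<close>

lemma no_cell_simps:
  assumes "0 < j"
  shows "0 < i \<Longrightarrow> i < length q \<Longrightarrow> j < length q \<Longrightarrow> (\<forall>x\<in>set w. \<not> cell w q vs (i, j) x) \<longleftrightarrow>
      clear (vs ! (q ! (i - 1) - 1)) (vs ! (q ! i - 1)) (\<lambda>x. vs ! (j - 1) < x \<and> x < vs ! j)"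
    and "0 < i \<Longrightarrow> i < length q \<Longrightarrow> j = length q \<Longrightarrow> (\<forall>x\<in>set w. \<not> cell w q vs (i, j) x) \<longleftrightarrow>
      clear (vs ! (q ! (i - 1) - 1)) (vs ! (q ! i - 1)) (\<lambda>x. vs ! (j - 1) < x)"
    and "0 < length q \<Longrightarrow> j < length q \<Longrightarrow> (\<forall>x\<in>set w. \<not> cell w q vs (0, j) x) \<longleftrightarrow>
      clear_left (vs ! (q ! 0 - 1)) (\<lambda>x. vs ! (j - 1) < x \<and> x < vs ! j)"
  using assms by (auto simp: cell_def clear_def clear_left_def)

lemma decreasing_cell_simp:
  assumes "0 < i" "i < length q" "0 < j" "j < length q"
  shows "(\<forall>x\<in>set w. \<forall>y\<in>set w. pos w x < pos w y \<and> cell w q vs (i, j) x \<and> cell w q vs (i, j) y \<longrightarrow> y < x) \<longleftrightarrow>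
      decreasing_between (vs ! (q ! (i - 1) - 1)) (vs ! (q ! i - 1)) (\<lambda>x. vs ! (j - 1) < x \<and> x < vs ! j)"
  unfolding decreasing_between_def cell_def fst_conv snd_conv using assms
  by (intro ball_cong refl iffI impI) auto

lemma occurs_at_order:
  assumes "occurs_at w (q, R, D) vs"
  shows "sorted_wrt (<) vs" "set vs \<subseteq> set w" "sorted_wrt (<) (map (\<lambda>r. pos w (vs ! (r - 1))) q)"
  using assms by (auto simp: occurs_at_def)

lemma occurs_23451: "occurs_at w (west3_patterns ! 0) [a,b,c,d,e] \<longleftrightarrow>
    a < b \<and> b < c \<and> c < d \<and> d < e \<and> in_order [b,c,d,e,a]"
  unfolding west3_nth occurs_at_def cell_def in_order_def clear_def
  by auto

text \<open>The order facts are extracted first, because \<open>clear_above\<close> merges stacked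
  boxes only when the separating entry is known to lie outside the column. The same scheme serves
  the eight lemmas that follow.\<close>

lemma occurs_24351: "occurs_at w (west3_patterns ! 1) [a,b,c,d,e] \<longleftrightarrow>
    a < b \<and> b < c \<and> c < d \<and> d < e \<and> in_order [b,d,c,e,a] \<and> clear d c (\<lambda>x. d < x)"
  (is "?occ \<longleftrightarrow> ?R")
proof -
  have "a < b \<and> b < c \<and> c < d \<and> d < e \<and> in_order [b,d,c,e,a]" if ?occ
    using occurs_at_order[OF that[unfolded west3_nth]] by (simp add: in_order_def)
  moreover have "?occ \<longleftrightarrow> ?R" if "a < b \<and> b < c \<and> c < d \<and> d < e \<and> in_order [b,d,c,e,a]"
    using that unfolding west3_nth
    by (simp add: occurs_at_def in_order_def no_cell_simps decreasing_cell_simp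
        clear_above[where c = c and d = d] clear_above[where c = d and d = e])
  ultimately show ?thesis by blast
qed

lemma occurs_32451: "occurs_at w (west3_patterns ! 2) [a,b,c,d,e] \<longleftrightarrow>
    a < b \<and> b < c \<and> c < d \<and> d < e \<and> in_order [c,b,d,e,a] \<and> clear c b (\<lambda>x. c < x)"
  (is "?occ \<longleftrightarrow> ?R")
proof -
  have "a < b \<and> b < c \<and> c < d \<and> d < e \<and> in_order [c,b,d,e,a]" if ?occ
    using occurs_at_order[OF that[unfolded west3_nth]] by (simp add: in_order_def)
  moreover have "?occ \<longleftrightarrow> ?R" if "a < b \<and> b < c \<and> c < d \<and> d < e \<and> in_order [c,b,d,e,a]"
    using that unfolding west3_nth
    by (simp add: occurs_at_def in_order_def no_cell_simps decreasing_cell_simp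
        clear_above[where c = c and d = d] clear_above[where c = d and d = e])
  ultimately show ?thesis by blast
qed

lemma occurs_42351: "occurs_at w (west3_patterns ! 3) [a,b,c,d,e] \<longleftrightarrow>
    a < b \<and> b < c \<and> c < d \<and> d < e \<and> in_order [d,b,c,e,a] \<and> clear d b (\<lambda>x. d < x) \<and> clear b c (\<lambda>x. d < x)"
  (is "?occ \<longleftrightarrow> ?R")
proof -
  have "a < b \<and> b < c \<and> c < d \<and> d < e \<and> in_order [d,b,c,e,a]" if ?occ
    using occurs_at_order[OF that[unfolded west3_nth]] by (simp add: in_order_def)
  moreover have "?occ \<longleftrightarrow> ?R" if "a < b \<and> b < c \<and> c < d \<and> d < e \<and> in_order [d,b,c,e,a]"
    using that unfolding west3_nth
    by (simp add: occurs_at_def in_order_def no_cell_simps decreasing_cell_simp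
        clear_above[where c = c and d = d] clear_above[where c = d and d = e])
  ultimately show ?thesis by blast
qed

lemma occurs_43251: "occurs_at w (west3_patterns ! 4) [a,b,c,d,e] \<longleftrightarrow>
    a < b \<and> b < c \<and> c < d \<and> d < e \<and> in_order [d,c,b,e,a] \<and> clear d c (\<lambda>x. d < x) \<and> clear c b (\<lambda>x. c < x)"
  (is "?occ \<longleftrightarrow> ?R")
proof -
  have "a < b \<and> b < c \<and> c < d \<and> d < e \<and> in_order [d,c,b,e,a]" if ?occ
    using occurs_at_order[OF that[unfolded west3_nth]] by (simp add: in_order_def)
  moreover have "?occ \<longleftrightarrow> ?R" if "a < b \<and> b < c \<and> c < d \<and> d < e \<and> in_order [d,c,b,e,a]"
    using that unfolding west3_nth
    by (simp add: occurs_at_def in_order_def no_cell_simps decreasing_cell_simp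
        clear_above[where c = c and d = d] clear_above[where c = d and d = e])
  ultimately show ?thesis by blast
qed

lemma occurs_34251: "occurs_at w (west3_patterns ! 5) [a,b,c,d,e] \<longleftrightarrow>
    a < b \<and> b < c \<and> c < d \<and> d < e \<and> in_order [c,d,b,e,a] \<and> clear c d (\<lambda>x. c < x) \<and> clear d b (\<lambda>x. d < x)"
  (is "?occ \<longleftrightarrow> ?R")
proof -
  have "a < b \<and> b < c \<and> c < d \<and> d < e \<and> in_order [c,d,b,e,a]" if ?occ
    using occurs_at_order[OF that[unfolded west3_nth]] by (simp add: in_order_def)
  moreover have "?occ \<longleftrightarrow> ?R" if "a < b \<and> b < c \<and> c < d \<and> d < e \<and> in_order [c,d,b,e,a]"
    using that unfolding west3_nth
    by (simp add: occurs_at_def in_order_def no_cell_simps decreasing_cell_simp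
        clear_above[where c = c and d = d] clear_above[where c = d and d = e])
  ultimately show ?thesis by blast
qed

text \<open>Rows 4 and 5 of column 0 merge because e stands further right. In column 2 the shaded
  rows 4 and 6 enclose the decorated row 5, hence the disjunction.\<close>

lemma occurs_362451: "occurs_at w (west3_patterns ! 6) [a,b,c,d,e,f] \<longleftrightarrow>
    a < b \<and> b < c \<and> c < d \<and> d < e \<and> e < f \<and> in_order [c,f,b,d,e,a] \<and>
    clear_left c (\<lambda>x. d < x \<and> x < f) \<and> clear c f (\<lambda>x. c < x) \<and>
    clear f b (\<lambda>x. d < x \<and> x < e \<or> f < x) \<and> decreasing_between f b (\<lambda>x. e < x \<and> x < f)"
  (is "?occ \<longleftrightarrow> ?R")
proof -
  have "a < b \<and> b < c \<and> c < d \<and> d < e \<and> e < f \<and> in_order [c,f,b,d,e,a]" if ?occ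
    using occurs_at_order[OF that[unfolded west3_nth]] by (simp add: in_order_def)
  moreover have "?occ \<longleftrightarrow> ?R" if "a < b \<and> b < c \<and> c < d \<and> d < e \<and> e < f \<and> in_order [c,f,b,d,e,a]"
    using that unfolding west3_nth
    by (simp add: occurs_at_def in_order_def no_cell_simps decreasing_cell_simp
        clear_above[where c = c and d = d] clear_above[where c = d and d = e]
        clear_above[where c = e and d = f] clear_split_disj clear_left_split[of d e f])
  ultimately show ?thesis by blast
qed

lemma occurs_364251: "occurs_at w (west3_patterns ! 7) [a,b,c,d,e,f] \<longleftrightarrow>
    a < b \<and> b < c \<and> c < d \<and> d < e \<and> e < f \<and> in_order [c,f,d,b,e,a] \<and>
    clear_left c (\<lambda>x. d < x \<and> x < f) \<and> clear c f (\<lambda>x. c < x) \<and>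
    clear f d (\<lambda>x. d < x \<and> x < e \<or> f < x) \<and> clear d b (\<lambda>x. d < x) \<and>
    decreasing_between f d (\<lambda>x. e < x \<and> x < f)"
  (is "?occ \<longleftrightarrow> ?R")
proof -
  have "a < b \<and> b < c \<and> c < d \<and> d < e \<and> e < f \<and> in_order [c,f,d,b,e,a]" if ?occ
    using occurs_at_order[OF that[unfolded west3_nth]] by (simp add: in_order_def)
  moreover have "?occ \<longleftrightarrow> ?R" if "a < b \<and> b < c \<and> c < d \<and> d < e \<and> e < f \<and> in_order [c,f,d,b,e,a]"
    using that unfolding west3_nth
    by (simp add: occurs_at_def in_order_def no_cell_simps decreasing_cell_simp
        clear_above[where c = c and d = d] clear_above[where c = d and d = e]
        clear_above[where c = e and d = f] clear_split_disj clear_left_split[of d e f])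
  ultimately show ?thesis by blast
qed

lemma occurs_7362451: "occurs_at w (west3_patterns ! 8) [a,b,c,d,e,f,g] \<longleftrightarrow>
    a < b \<and> b < c \<and> c < d \<and> d < e \<and> e < f \<and> f < g \<and> in_order [g,c,f,b,d,e,a] \<and>
    clear g c (\<lambda>x. d < x) \<and> clear c f (\<lambda>x. c < x) \<and>
    clear f b (\<lambda>x. d < x \<and> x < e \<or> f < x) \<and> decreasing_between f b (\<lambda>x. e < x \<and> x < f)"
  (is "?occ \<longleftrightarrow> ?R")
proof -
  have "a < b \<and> b < c \<and> c < d \<and> d < e \<and> e < f \<and> f < g \<and> in_order [g,c,f,b,d,e,a]" if ?occ
    using occurs_at_order[OF that[unfolded west3_nth]] by (simp add: in_order_def)
  moreover have "?occ \<longleftrightarrow> ?R" if "a < b \<and> b < c \<and> c < d \<and> d < e \<and> e < f \<and> f < g \<and> in_order [g,c,f,b,d,e,a]"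
    using that unfolding west3_nth
    by (simp add: occurs_at_def in_order_def no_cell_simps decreasing_cell_simp
        clear_above[where c = c and d = d] clear_above[where c = d and d = e]
        clear_above[where c = e and d = f] clear_above[where c = f and d = g] clear_split_disj)
  ultimately show ?thesis by blast
qed

lemma occurs_7364251: "occurs_at w (west3_patterns ! 9) [a,b,c,d,e,f,g] \<longleftrightarrow>
    a < b \<and> b < c \<and> c < d \<and> d < e \<and> e < f \<and> f < g \<and> in_order [g,c,f,d,b,e,a] \<and>
    clear g c (\<lambda>x. d < x) \<and> clear c f (\<lambda>x. c < x) \<and>
    clear f d (\<lambda>x. d < x \<and> x < e \<or> f < x) \<and> clear d b (\<lambda>x. d < x) \<and>
    decreasing_between f d (\<lambda>x. e < x \<and> x < f)"
  (is "?occ \<longleftrightarrow> ?R")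
proof -
  have "a < b \<and> b < c \<and> c < d \<and> d < e \<and> e < f \<and> f < g \<and> in_order [g,c,f,d,b,e,a]" if ?occ
    using occurs_at_order[OF that[unfolded west3_nth]] by (simp add: in_order_def)
  moreover have "?occ \<longleftrightarrow> ?R" if "a < b \<and> b < c \<and> c < d \<and> d < e \<and> e < f \<and> f < g \<and> in_order [g,c,f,d,b,e,a]"
    using that unfolding west3_nth
    by (simp add: occurs_at_def in_order_def no_cell_simps decreasing_cell_simp
        clear_above[where c = c and d = d] clear_above[where c = d and d = e]
        clear_above[where c = e and d = f] clear_above[where c = f and d = g] clear_split_disj)
  ultimately show ?thesis by blast
qed

lemma contains_west3_iff:
  "(\<exists>P\<in>set west3_patterns. contains_pat w P) \<longleftrightarrow> (\<exists>P\<in>set west3_patterns. \<exists>vs. occurs_at w P vs)"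
proof (rule bex_cong)
  fix P assume "P \<in> set west3_patterns"
  then have "is_perm (fst P) \<and>
      (\<forall>ab \<in> fst (snd P) \<union> snd (snd P). fst ab \<le> length (fst P) \<and> snd ab \<le> length (fst P))"
    unfolding west3_patterns_def by (auto simp: is_perm_def)
  then show "contains_pat w P \<longleftrightarrow> (\<exists>vs. occurs_at w P vs)"
    using contains_pat_iff[OF perm, of "fst P" "fst (snd P)" "snd (snd P)"] by auto
qed simp

section \<open>From pattern occurrences to unsortability\<close>

lemma unsortable_if_occurs:
  assumes P: "P \<in> set west3_patterns" and occ: "occurs_at w P vs"
  shows unsortable
proof -
  have len: "length vs = length (fst P)" using occ by (auto simp: occurs_at_def)
  have dec5: "\<exists>a b c d e. vs = [a,b,c,d,e]" if "length vs = 5"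
    using that by (auto simp: numeral_eq_Suc length_Suc_conv)
  have dec6: "\<exists>a b c d e f. vs = [a,b,c,d,e,f]" if "length vs = 6"
    using that by (auto simp: numeral_eq_Suc length_Suc_conv)
  have dec7: "\<exists>a b c d e f g. vs = [a,b,c,d,e,f,g]" if "length vs = 7"
    using that by (auto simp: numeral_eq_Suc length_Suc_conv)
  consider "P \<in> {west3_patterns ! 0, west3_patterns ! 1, west3_patterns ! 2, west3_patterns ! 3,
      west3_patterns ! 4, west3_patterns ! 5}"
    | "P \<in> {west3_patterns ! 6, west3_patterns ! 7}" | "P \<in> {west3_patterns ! 8, west3_patterns ! 9}"
    using P unfolding in_west3_iff by blast
  then show ?thesis
  proof cases
    case 1
    then have "length vs = 5" using len unfolding west3_nth by auto
    then obtain a b c d e where "vs = [a,b,c,d,e]" using dec5 by blast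
    then have occ5: "occurs_at w P [a,b,c,d,e]" using occ by simp
    consider "in_order [b,c,d,e,a]" | "in_order [b,d,c,e,a] \<and> clear d c (\<lambda>x. d < x)"
      | "in_order [c,b,d,e,a] \<and> clear c b (\<lambda>x. c < x)"
      | "in_order [d,b,c,e,a] \<and> clear d b (\<lambda>x. d < x) \<and> clear b c (\<lambda>x. d < x)"
      | "in_order [d,c,b,e,a] \<and> clear d c (\<lambda>x. d < x) \<and> clear c b (\<lambda>x. c < x)"
      | "in_order [c,d,b,e,a] \<and> clear c d (\<lambda>x. c < x) \<and> clear d b (\<lambda>x. d < x)"
      using 1 occ5 by (auto simp: occurs_23451 occurs_24351 occurs_32451 occurs_42351 occurs_43251 occurs_34251 simp del: One_nat_def)
    moreover have ord: "a < b" "b < c" "c < d" "d < e" using occ5 by (auto simp: occurs_at_def)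
    ultimately show ?thesis
    proof cases
      case 1
      then show ?thesis using unsortable_23451 ord by blast
    next
      case 2
      then show ?thesis
        using ord by (intro unsortableI[of a b c d e] noninv2_if_before) (auto simp: in_order_def noninv1_def clear_def)
    next
      case 3
      then show ?thesis
        using ord by (intro unsortableI[of a b c d e] noninv2_if_clear noninv1_if_before) (auto simp: in_order_def)
    next
      case 4
      then have A: "a \<in> set w" "b \<in> set w" "c \<in> set w" "d \<in> set w" "e \<in> set w"
        and p: "pos w d < pos w b" "pos w b < pos w c" "pos w c < pos w e" "pos w e < pos w a"
        by (auto simp: in_order_def)
      \<comment> \<open>The shading comes in two columns separated by b, which is itself smaller
        than d.\<close>
      have "noninv1 d c"
        unfolding noninv1_def
      proof (intro ballI impI notI)
        fix x assume x: "x \<in> set w" "d < x" "pos w d < pos w x \<and> pos w x < pos w c"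
        have "pos w x \<noteq> pos w b" using p_eq[of x b] x ord A by auto
        then show False using 4 x clearD[of d b _ x] clearD[of b c _ x] by (meson linorder_neqE_nat)
      qed
      then show ?thesis
        using ord A p by (intro unsortableI[of a b c d e] noninv2_if_before) auto
    next
      case 5
      then show ?thesis
        using ord by (intro unsortableI[of a b c d e] noninv2_if_clear) (auto simp: in_order_def noninv1_def clear_def)
    next
      case 6
      then show ?thesis using unsortable_34251[of a b c d e] ord by blast
    qed
  next
    case 2
    then have "length vs = 6" using len unfolding west3_nth by auto
    then obtain a b c d e f where "vs = [a,b,c,d,e,f]" using dec6 by blast
    then have occ6: "occurs_at w P [a,b,c,d,e,f]" using occ by simp
    consider "in_order [c,f,b,d,e,a]" "clear_left c (\<lambda>x. d < x \<and> x < f)" "clear c f (\<lambda>x. c < x)"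
        "clear f b (\<lambda>x. d < x \<and> x < e \<or> f < x)" "decreasing_between f b (\<lambda>x. e < x \<and> x < f)"
      | "in_order [c,f,d,b,e,a]" "clear_left c (\<lambda>x. d < x \<and> x < f)" "clear c f (\<lambda>x. c < x)"
        "clear f d (\<lambda>x. d < x \<and> x < e \<or> f < x)" "clear d b (\<lambda>x. d < x)"
        "decreasing_between f d (\<lambda>x. e < x \<and> x < f)"
      using 2 occ6 by (auto simp: occurs_362451 occurs_364251 simp del: One_nat_def)
    moreover have ord: "a < b" "b < c" "c < d" "d < e" "e < f" using occ6 by (auto simp: occurs_at_def)
    ultimately show ?thesis
    proof cases
      case 1
      \<comment> \<open>Here b precedes d, so the shading between d and b is vacuous, and
        \<open>clear_left\<close> makes the condition on entries left of c vacuous.\<close>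
      show ?thesis
        by (rule unsortable_decorated[of a b c d e f])
          (use 1 ord in \<open>auto simp: in_order_def clear_def clear_left_def\<close>)
    next
      case 2
      then show ?thesis using ord
        by (intro unsortable_decorated[of a b c d e f])
          (auto simp: in_order_def clear_left_def intro: clear_extend decreasing_extend)
    qed
  next
    case 3
    then have "length vs = 7" using len unfolding west3_nth by auto
    then obtain a b c d e f g where "vs = [a,b,c,d,e,f,g]" using dec7 by blast
    then have occ7: "occurs_at w P [a,b,c,d,e,f,g]" using occ by simp
    consider "in_order [g,c,f,b,d,e,a]" "clear g c (\<lambda>x. d < x)" "clear c f (\<lambda>x. c < x)"
        "clear f b (\<lambda>x. d < x \<and> x < e \<or> f < x)" "decreasing_between f b (\<lambda>x. e < x \<and> x < f)"
      | "in_order [g,c,f,d,b,e,a]" "clear g c (\<lambda>x. d < x)" "clear c f (\<lambda>x. c < x)"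
        "clear f d (\<lambda>x. d < x \<and> x < e \<or> f < x)" "clear d b (\<lambda>x. d < x)"
        "decreasing_between f d (\<lambda>x. e < x \<and> x < f)"
      using 3 occ7 by (auto simp: occurs_7362451 occurs_7364251 simp del: One_nat_def)
    moreover have ord: "a < b" "b < c" "c < d" "d < e" "e < f" "f < g" using occ7 by (auto simp: occurs_at_def)
    ultimately show ?thesis
    proof cases
      case 1
      have "g \<in> set w" "pos w g < pos w c" using 1(1) by (auto simp: in_order_def)
      \<comment> \<open>The entry g is a common witness: an x with d < x cannot stand between g and
        c, so it precedes g.\<close>
      then have left: "\<exists>g\<in>set w. f < g \<and> pos w x < pos w g \<and> pos w g < pos w c"
        if "x \<in> set w" "pos w x < pos w c" "d < x" "x < f" for x
        using that clearD[OF 1(2), of x] p_eq[of x g] ord by (metis linorder_neqE_nat order_less_asym)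
      show ?thesis
        by (rule unsortable_decorated[of a b c d e f])
          (use 1 ord left in \<open>auto simp: in_order_def clear_def\<close>)
    next
      case 2
      have "g \<in> set w" "pos w g < pos w c" using 2(1) by (auto simp: in_order_def)
      then have left: "\<exists>g\<in>set w. f < g \<and> pos w x < pos w g \<and> pos w g < pos w c"
        if "x \<in> set w" "pos w x < pos w c" "d < x" "x < f" for x
        using that clearD[OF 2(2), of x] p_eq[of x g] ord by (metis linorder_neqE_nat order_less_asym)
      then show ?thesis using 2 ord
        by (intro unsortable_decorated[of a b c d e f])
          (auto simp: in_order_def intro: clear_extend decreasing_extend)
    qed
  qed
qed

section \<open>From unsortability to pattern occurrences\<close>

lemma occurs_if_unsortable:
  assumes unsortable
  shows "\<exists>P\<in>set west3_patterns. \<exists>vs. occurs_at w P vs"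
proof -
  have "length west3_patterns = 10" by (simp add: west3_patterns_def)
  then have found: ?thesis if "occurs_at w (west3_patterns ! i) vs" "i < 10" for i vs
    using that nth_mem[of i west3_patterns] by auto
  obtain a b c d e where A: "a \<in> set w" "b \<in> set w" "c \<in> set w" "d \<in> set w" "e \<in> set w"
    and ord: "a < b" "b < c" "c < d" "d < e" and p: "pos w d < pos w e" "pos w e < pos w a"
    and noninv1: "noninv1 d c" and noninv2: "noninv2 c b"
    using assms unfolding unsortable_def by blast
  have noninv1': "clear d c (\<lambda>x. d < x)" using noninv1 unfolding noninv1_def clear_def by blast
  have "pos w c \<noteq> pos w e" "pos w b \<noteq> pos w e" "pos w b \<noteq> pos w c" "pos w b \<noteq> pos w d" "pos w c \<noteq> pos w d"
    using A ord p_eq[of c e] p_eq[of b e] p_eq[of b c] p_eq[of b d] p_eq[of c d] by auto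
  note ne = this
  \<comment> \<open>Before c, the entry e would itself violate \<open>noninv1 d c\<close>.\<close>
  have "\<not> pos w e < pos w c" using noninv1 A ord p unfolding noninv1_def by auto
  then have ce: "pos w c < pos w e" using ne by auto
  \<comment> \<open>Before b, the ascent d, e would give by \<open>noninv2\<close> an entry above d
    between d and c, against \<open>noninv1\<close>.\<close>
  have "\<not> pos w e < pos w b"
    using noninv2 A ord p noninv1 unfolding noninv2_def noninv1_def by blast
  then have be: "pos w b < pos w e" using ne by auto
  consider "pos w b < pos w c" | "pos w c < pos w b" "clear c b (\<lambda>x. c < x)"
    | "pos w c < pos w b" "\<not> clear c b (\<lambda>x. c < x)" using ne by linarith
  then show ?thesis
  proof cases
    case 1
    consider "pos w c < pos w d" | "pos w b < pos w d" "pos w d < pos w c" | "pos w d < pos w b"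
      using ne by linarith
    then show ?thesis
    proof cases
      case order: 1
      have "occurs_at w (west3_patterns ! 0) [a,b,c,d,e]"
        using A ord p 1 order unfolding occurs_23451 by (auto simp: in_order_def)
      then show ?thesis by (rule found) simp
    next
      case 2
      have "occurs_at w (west3_patterns ! 1) [a,b,c,d,e]"
        using A ord p ce noninv1' 1 2 unfolding occurs_24351 by (auto simp: in_order_def)
      then show ?thesis by (rule found) simp
    next
      case 3
      have "clear d b (\<lambda>x. d < x)" "clear b c (\<lambda>x. d < x)"
        using noninv1' 1 3 unfolding clear_def by (meson order.strict_trans)+
      then have "occurs_at w (west3_patterns ! 3) [a,b,c,d,e]"
        using A ord p ce 1 3 unfolding occurs_42351 by (auto simp: in_order_def)
      then show ?thesis by (rule found) simp
    qed
  next
    case 2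
    have "\<not> (pos w c < pos w d \<and> pos w d < pos w b)" using 2(2) A ord unfolding clear_def by auto
    then consider "pos w b < pos w d" | "pos w d < pos w c" using 2(1) ne by linarith
    then show ?thesis
    proof cases
      case 1
      have "occurs_at w (west3_patterns ! 2) [a,b,c,d,e]"
        using A ord p 1 2 unfolding occurs_32451 by (auto simp: in_order_def)
      then show ?thesis by (rule found) simp
    next
      case order: 2
      have "occurs_at w (west3_patterns ! 4) [a,b,c,d,e]"
        using A ord p be 2 order noninv1' unfolding occurs_43251 by (auto simp: in_order_def)
      then show ?thesis by (rule found) simp
    qed
  next
    case 3
    define X where "X = (\<lambda>x. x \<in> set w \<and> c < x \<and> pos w c < pos w x \<and> pos w x < pos w b)"
    have "\<exists>x. X x" using 3(2) unfolding clear_def X_def by blast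
    then obtain f where f: "X f" and first: "\<And>x. X x \<Longrightarrow> pos w f \<le> pos w x"
      using ex_has_least_nat[of X _ "pos w"] by blast
    have fA: "f \<in> set w" "c < f" "pos w c < pos w f" "pos w f < pos w b" using f unfolding X_def by auto
    have cf: "clear c f (\<lambda>x. c < x)"
      unfolding clear_def
    proof (intro ballI impI notI)
      fix x assume "x \<in> set w" "pos w c < pos w x \<and> pos w x < pos w f" "c < x"
      then show False using first[of x] fA unfolding X_def by auto
    qed
    \<comment> \<open>For an ascent right of c, \<open>noninv2\<close> would demand a z that lies
      right of x and yet left of c.\<close>
    have dec: "decreasing_between c b (\<lambda>x. c < x)"
      unfolding decreasing_between_def
    proof (intro ballI impI, rule ccontr)
      fix x y
      assume xy: "x \<in> set w" "y \<in> set w"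
        "pos w c < pos w x \<and> pos w x < pos w y \<and> pos w y < pos w b \<and> c < x \<and> c < y" "\<not> y < x"
      then have "x < y" by (metis nat_neq_iff)
      then obtain z where "pos w x < pos w z" "pos w z < pos w c" using noninv2 xy unfolding noninv2_def by blast
      then show False using xy by auto
    qed
    have fb: "clear f b (\<lambda>x. f < x)"
      unfolding clear_def
    proof (intro ballI impI notI)
      fix x assume "x \<in> set w" "pos w f < pos w x \<and> pos w x < pos w b" "f < x"
      then show False using decreasing_betweenD[OF dec, of f x] fA by auto
    qed
    \<comment> \<open>This is \<open>noninv2\<close> for the ascent x, f.\<close>
    have left: "\<exists>z\<in>set w. x < z \<and> pos w x < pos w z \<and> pos w z < pos w c"
      if "x \<in> set w" "pos w x < pos w c" "c < x" "x < f" for x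
      using that noninv2 fA unfolding noninv2_def by (meson order.strict_trans)
    have f_ne: "f \<noteq> e" using fA be by auto
    show ?thesis
    proof (cases "f < e")
      case True
      \<comment> \<open>The entry f takes the place of d.\<close>
      have "occurs_at w (west3_patterns ! 5) [a,b,c,f,e]"
        using A ord p be fA cf fb True unfolding occurs_34251 by (auto simp: in_order_def)
      then show ?thesis by (rule found) simp
    next
      case False
      then have ef: "e < f" using f_ne by auto
      have cd: "pos w c < pos w d"
      proof (rule ccontr)
        assume "\<not> pos w c < pos w d"
        then have "pos w d < pos w c" using ne by auto
        then show False using left[of d] A ord ef noninv1 unfolding noninv1_def by auto
      qed
      \<comment> \<open>The entry d is replaced by the largest possible m, so that no entry standing
        between c and e has a value between m and e. This gives the shading just below the decorated
        box.\<close>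
      define Y where "Y = (\<lambda>x. x \<in> set w \<and> c < x \<and> x < e \<and> pos w c < pos w x \<and> pos w x < pos w e)"
      have "Y d" using A ord p cd unfolding Y_def by auto
      then obtain m where m: "Y m" and max: "\<And>x. Y x \<Longrightarrow> x \<le> m"
        using ex_has_greatest_nat[of Y d "\<lambda>x. x" e] unfolding Y_def by auto
      have mA: "m \<in> set w" "c < m" "m < e" "pos w c < pos w m" "pos w m < pos w e"
        using m unfolding Y_def by auto
      have "pos w m \<noteq> pos w f" "pos w m \<noteq> pos w b"
        using p_eq[of m f] p_eq[of m b] mA fA A ef ord by auto
      note mne = this
      have "\<not> pos w m < pos w f" using clearD[OF cf, of m] mA by auto
      then have fm: "pos w f < pos w m" using mne by auto
      have me: "\<not> (m < x \<and> x < e)" if "x \<in> set w" "pos w c < pos w x" "pos w x < pos w e" for x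
        using max[of x] that mA unfolding Y_def by auto
      have fX: "clear f b (\<lambda>x. m < x \<and> x < e \<or> f < x)"
        unfolding clear_split_disj using fb me fA be by (auto simp: clear_def)
      have decf: "decreasing_between f b (\<lambda>x. e < x \<and> x < f)"
        unfolding decreasing_between_def
      proof (intro ballI impI)
        fix x y
        assume "x \<in> set w" "y \<in> set w" "pos w f < pos w x \<and> pos w x < pos w y \<and> pos w y < pos w b
          \<and> (e < x \<and> x < f) \<and> e < y \<and> y < f"
        then show "y < x" using decreasing_betweenD[OF dec, of x y] fA ord by auto
      qed
      \<comment> \<open>Repeated use of \<open>left\<close>: an entry with value between c and f
        leads to a larger one closer to c, which again lies below f because \<open>none\<close>
        excludes larger values. This cannot go on forever. The parameter l marks where the region
        free of entries above f begins.\<close>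
      have clear_to_c: "\<not> (c < x \<and> x < f)"
        if x: "x \<in> set w" "l \<le> pos w x" "pos w x < pos w c"
          and none: "\<And>z. z \<in> set w \<Longrightarrow> l \<le> pos w z \<Longrightarrow> pos w z < pos w c \<Longrightarrow> \<not> f < z" for x l
        using x
      proof (induction "pos w c - pos w x" arbitrary: x rule: less_induct)
        case less
        show ?case
        proof
          assume "c < x \<and> x < f"
          then obtain z where z: "z \<in> set w" "x < z" "pos w x < pos w z" "pos w z < pos w c"
            using left[of x] less.prems by auto
          then have "\<not> f < z" using none[of z] less.prems by auto
          moreover have "z \<noteq> f" using z fA by auto
          moreover have "pos w c - pos w z < pos w c - pos w x" using z by linarith
          ultimately show False
            using less.hyps[of z] z less.prems \<open>c < x \<and> x < f\<close> by auto
        qed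
      qed
      have mb: "clear m b (\<lambda>x. m < x)" if "pos w m < pos w b"
        unfolding clear_def
      proof (intro ballI impI notI)
        fix x assume "x \<in> set w" "pos w m < pos w x \<and> pos w x < pos w b" "m < x"
        then show False using decreasing_betweenD[OF dec, of m x] mA by auto
      qed
      have fX': "clear f m (\<lambda>x. m < x \<and> x < e \<or> f < x)" and decf': "decreasing_between f m (\<lambda>x. e < x \<and> x < f)"
        if "pos w m < pos w b"
        using fX decf that unfolding clear_def decreasing_between_def by (meson order.strict_trans)+
      show ?thesis
      proof (cases "\<exists>g\<in>set w. f < g \<and> pos w g < pos w c")
        case False
        have "clear_left c (\<lambda>x. m < x \<and> x < f)"
          unfolding clear_left_def using clear_to_c[of _ 0] False mA by fastforce
        \<comment> \<open>Which of the two patterns occurs depends on whether m stands after or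
          before b.\<close>
        then have "occurs_at w (west3_patterns ! 6) [a,b,c,m,e,f] \<or> occurs_at w (west3_patterns ! 7) [a,b,c,m,e,f]"
          using A ord p be fA mA ef fm mne cf fX decf fX' decf' mb unfolding occurs_362451 occurs_364251
          by (cases "pos w m < pos w b") (auto simp: in_order_def)
        then show ?thesis using found by (elim disjE) simp_all
      next
        case True
        \<comment> \<open>The last entry above f to the left of c plays the 7 of the
          pattern.\<close>
        then obtain g where g: "g \<in> set w \<and> f < g \<and> pos w g < pos w c"
          and last: "\<And>z. z \<in> set w \<and> f < z \<and> pos w z < pos w c \<Longrightarrow> pos w z \<le> pos w g"
          using ex_has_greatest_nat[of "\<lambda>g. g \<in> set w \<and> f < g \<and> pos w g < pos w c" _ "pos w" "pos w c"]
          by (metis nless_le)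
        \<comment> \<open>Between g and c, values from m up to f are excluded by
          \<open>clear_to_c\<close> with l one past the position of g, the value f because f stands
          right of c, and larger values by the choice of g.\<close>
        have "clear g c (\<lambda>x. m < x)"
          unfolding clear_def
        proof (intro ballI impI notI)
          fix x assume x: "x \<in> set w" "pos w g < pos w x \<and> pos w x < pos w c" "m < x"
          have none: "\<not> f < z" if "z \<in> set w" "Suc (pos w g) \<le> pos w z" "pos w z < pos w c" for z
            using last[of z] that by auto
          have "x \<noteq> f" using x fA by auto
          then show False using clear_to_c[of x "Suc (pos w g)", OF _ _ _ none] none[of x] x mA by auto
        qed
        then have "occurs_at w (west3_patterns ! 8) [a,b,c,m,e,f,g] \<or> occurs_at w (west3_patterns ! 9) [a,b,c,m,e,f,g]"
          using A ord p be fA mA ef fm mne cf fX decf fX' decf' mb g unfolding occurs_7362451 occurs_7364251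
          by (cases "pos w m < pos w b") (auto simp: in_order_def)
        then show ?thesis using found by (elim disjE) simp_all
      qed
    qed
  qed
qed

lemma unsortable_iff_contains: "unsortable \<longleftrightarrow> (\<exists>P\<in>set west3_patterns. contains_pat w P)"
  using occurs_if_unsortable unsortable_if_occurs contains_west3_iff by blast

end

theorem theorem3p9:
  assumes "is_perm w"
  shows "(stack_sort ^^ 3) w = [1..<length w + 1]
         \<longleftrightarrow> (\<forall>P \<in> set west3_patterns. avoids_pat w P)"
proof -
  have w: "distinct w" "set w = {1..length w}" using assms by (auto simp: is_perm_def)
  have s: "distinct ((stack_sort ^^ n) w) \<and> set ((stack_sort ^^ n) w) = set w" for n
    by (induction n) (use w set_distinct_stack_sort in auto)
  \<comment> \<open>Sorting passes keep the entries 1..n distinct, and the only increasing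
    arrangement of these is the identity.\<close>
  have "(stack_sort ^^ 3) w = [1..<length w + 1] \<longleftrightarrow> sorted ((stack_sort ^^ 3) w)"
  proof
    assume "sorted ((stack_sort ^^ 3) w)"
    moreover have "set ((stack_sort ^^ 3) w) = set [1..<length w + 1]" using s[of 3] w(2) by auto
    ultimately show "(stack_sort ^^ 3) w = [1..<length w + 1]"
      using s[of 3] by (intro sorted_distinct_set_unique) (auto simp del: upt_Suc)
  qed (simp del: upt_Suc)
  then show ?thesis
    using unsorted_iff[OF w(1)] unsortable_iff_contains[OF assms] unfolding avoids_pat_def by blast
qed

end
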